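(* Let $n$ be a positive integer, let $z_i^0=(x_i^0,y_i^0)\in\mathcal U=\mathcal U_1\times\mathcal U_2$ for $i=1,\dots,n$, and consider the discrete systems on $\mathcal U_1$ and $\mathcal U_2$, $$x_i'(t)=\frac1n\sum_{j=1}^n\log_{x_i(t)}x_j(t),\quad x_i(0)=x_i^0,\qquad\qquad y_i'(t)=\frac1n\sum_{j=1}^n\log_{y_i(t)}y_j(t),\quad y_i(0)=y_i^0.$$ Suppose that these systems have unique global solutions $(x_i)_{i=1}^n$ and $(y_i)_{i=1}^n$ in $\mathcal U_1$ and $\mathcal U_2$, respectively, which satisfy, for every $i,j\in\{1,\dots,n\}$, $$d_1(x_i(t),x_j(t))\to0\quad\text{and}\quad d_2(y_i(t),y_j(t))\to0\qquad\text{as }t\to\infty.$$ Then the unique global solution $(z_i)_{i=1}^n:=((x_i,y_i))_{i=1}^n$ in $\mathcal U$ to $$z_i'(t)=\frac1n\sum_{j=1}^n\log_{z_i(t)}z_j(t),\qquad z_i(0)=z_i^0,$$ verifies, for every $i,j\in\{1,\dots,n\}$, $d(z_i(t),z_j(t))\to0$ as $t\to\infty$.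
   Context: $M_1,M_2$ are smooth, complete, connected Riemannian manifolds with intrinsic distances $d_1,d_2$; $M=M_1\times M_2$ carries the product metric, with distance $d((x,y),(\bar x,\bar y))=\sqrt{d_1(x,\bar x)^2+d_2(y,\bar y)^2}$. $\mathcal U_1\subset M_1$ and $\mathcal U_2\subset M_2$ are open and geodesically convex (any two points are joined by a unique minimizing geodesic, which stays in the set), and $\mathcal U=\mathcal U_1\times\mathcal U_2$. $\log$ denotes the Riemannian logarithm (inverse of the exponential map along minimizing geodesics) on the respective manifold; on $\mathcal U$, $\log_{(x,y)}(\bar x,\bar y)=(\log_x\bar x,\log_y\bar y)$. The systems are the discrete aggregation models with quadratic potential $K=\frac12(\text{distance})^2$, for which $\nabla K_{\bar z}(z)=-\log_z\bar z$. *)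

theory Defs
  imports "HOL-Analysis.Analysis"
begin

section \<open>Smooth maps between Euclidean spaces\<close>

text \<open>\<open>C\<^sup>k\<close> maps on an \<^emph>\<open>open\<close> set \<open>S\<close>, by recursion on \<open>k\<close> via directional derivatives.\<close>

primrec Ck_on :: "nat \<Rightarrow> 'a::euclidean_space set \<Rightarrow> ('a \<Rightarrow> 'b::euclidean_space) \<Rightarrow> bool" where
  "Ck_on 0 S f \<longleftrightarrow> continuous_on S f"
| "Ck_on (Suc k) S f \<longleftrightarrow> (\<forall>q\<in>S. f differentiable (at q)) \<and>
     (\<forall>v. Ck_on k S (\<lambda>q. frechet_derivative f (at q) v))"

definition smooth_on :: "'a::euclidean_space set \<Rightarrow> ('a \<Rightarrow> 'b::euclidean_space) \<Rightarrow> bool" where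
  "smooth_on S f \<longleftrightarrow> (\<forall>k. Ck_on k S f)"


section \<open>Riemannian manifolds\<close>

text \<open>
  A Riemannian structure is given by an indexed atlas together with the local expressions of the
  metric tensor: for a chart \<open>c\<close>, a coordinate vector \<open>q\<close> in the image of \<open>c\<close> and
  \<open>u\<close>, \<open>v\<close> in the model space, \<open>coeff M c q u v\<close> is
  \<open>\<Sum>\<^sub>k\<^sub>l g\<^sub>k\<^sub>l(q) u\<^sup>k v\<^sup>l\<close>. The underlying point set is the union of the
  chart domains; it carries the topology of the ambient type \<open>'a\<close>, in which it is open.
  The maps \<open>cmap M c\<close> are total functions, but only their values on \<open>cdom M c\<close> matter;
  likewise for \<open>coeff M c\<close> and the image of \<open>c\<close>.
\<close>

record ('i, 'a, 'e) riemannian =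
  charts :: "'i set"
  cdom :: "'i \<Rightarrow> 'a set"
  cmap :: "'i \<Rightarrow> 'a \<Rightarrow> 'e"
  coeff :: "'i \<Rightarrow> 'e \<Rightarrow> 'e \<Rightarrow> 'e \<Rightarrow> real"

definition points :: "('i, 'a, 'e) riemannian \<Rightarrow> 'a set" where
  "points M = (\<Union>c\<in>charts M. cdom M c)"

definition transition :: "('i, 'a, 'e) riemannian \<Rightarrow> 'i \<Rightarrow> 'i \<Rightarrow> 'e \<Rightarrow> 'e" where
  "transition M c c' = cmap M c' \<circ> inv_into (cdom M c) (cmap M c)"

definition riemannian_manifold ::
  "('i, 'a::{t2_space,second_countable_topology}, 'e::euclidean_space) riemannian \<Rightarrow> bool" where
  "riemannian_manifold M \<longleftrightarrow>
     (\<forall>c\<in>charts M. open (cdom M c) \<and> open (cmap M c ` cdom M c) \<and>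
        homeomorphism (cdom M c) (cmap M c ` cdom M c) (cmap M c)
          (inv_into (cdom M c) (cmap M c))) \<and>
     (\<forall>c\<in>charts M. \<forall>c'\<in>charts M.
        smooth_on (cmap M c ` (cdom M c \<inter> cdom M c')) (transition M c c')) \<and>
     (\<forall>c\<in>charts M. \<forall>u v. smooth_on (cmap M c ` cdom M c) (\<lambda>q. coeff M c q u v)) \<and>
     (\<forall>c\<in>charts M. \<forall>q\<in>cmap M c ` cdom M c.
        bilinear (coeff M c q) \<and>
        (\<forall>u v. coeff M c q u v = coeff M c q v u) \<and>
        (\<forall>u. u \<noteq> 0 \<longrightarrow> coeff M c q u u > 0)) \<and>
     (\<forall>c\<in>charts M. \<forall>c'\<in>charts M. \<forall>p\<in>cdom M c \<inter> cdom M c'. \<forall>u v.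
        coeff M c (cmap M c p) u v =
        coeff M c' (cmap M c' p)
          (frechet_derivative (transition M c c') (at (cmap M c p)) u)
          (frechet_derivative (transition M c c') (at (cmap M c p)) v))"

text \<open>The product atlas with the product metric.\<close>

definition riem_prod ::
  "('i, 'a, 'e) riemannian \<Rightarrow> ('j, 'b, 'f) riemannian \<Rightarrow> ('i \<times> 'j, 'a \<times> 'b, 'e \<times> 'f) riemannian"
  where
  "riem_prod M N =
    \<lparr> charts = charts M \<times> charts N,
      cdom = (\<lambda>(c, c'). cdom M c \<times> cdom N c'),
      cmap = (\<lambda>(c, c'). map_prod (cmap M c) (cmap N c')),
      coeff = (\<lambda>(c, c') q u v. coeff M c (fst q) (fst u) (fst v) + coeff N c' (snd q) (snd u) (snd v)) \<rparr>"


section \<open>Tangent vectors and velocities\<close>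

text \<open>
  A tangent vector at \<open>p\<close> is the family of its coordinate vectors in all charts around \<open>p\<close>,
  related by the differentials of the transition maps (and, by convention, \<open>0\<close> for the other
  indices, so that equal tangent vectors are equal functions). Linear operations are pointwise.
\<close>

definition tangent_space ::
  "('i, 'a, 'e::euclidean_space) riemannian \<Rightarrow> 'a \<Rightarrow> ('i \<Rightarrow> 'e) set" where
  "tangent_space M p = {v.
     (\<forall>c. \<not> (c \<in> charts M \<and> p \<in> cdom M c) \<longrightarrow> v c = 0) \<and>
     (\<forall>c\<in>charts M. \<forall>c'\<in>charts M. p \<in> cdom M c \<longrightarrow> p \<in> cdom M c' \<longrightarrow>
        v c' = frechet_derivative (transition M c c') (at (cmap M c p)) (v c))}"

text \<open>The value does not depend on the chosen chart, by the transformation law of \<open>coeff\<close>.\<close>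

definition riem_inner ::
  "('i, 'a, 'e) riemannian \<Rightarrow> 'a \<Rightarrow> ('i \<Rightarrow> 'e) \<Rightarrow> ('i \<Rightarrow> 'e) \<Rightarrow> real" where
  "riem_inner M p u v =
     (let c = (SOME c. c \<in> charts M \<and> p \<in> cdom M c) in coeff M c (cmap M c p) (u c) (v c))"

definition riem_norm :: "('i, 'a, 'e) riemannian \<Rightarrow> 'a \<Rightarrow> ('i \<Rightarrow> 'e) \<Rightarrow> real" where
  "riem_norm M p v = sqrt (riem_inner M p v v)"

text \<open>
  The curve \<open>\<gamma>\<close>, considered on the set \<open>S\<close> of times, has velocity \<open>v\<close> at time
  \<open>t\<close>. Continuity at \<open>t\<close> ensures that \<open>\<gamma>\<close> stays in the chart domain near \<open>t\<close>, so
  that the derivative of \<open>cmap M c \<circ> \<gamma>\<close> does not see values outside that domain.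
\<close>

definition has_velocity ::
  "('i, 'a::topological_space, 'e::euclidean_space) riemannian \<Rightarrow> real set \<Rightarrow> (real \<Rightarrow> 'a) \<Rightarrow>
   ('i \<Rightarrow> 'e) \<Rightarrow> real \<Rightarrow> bool" where
  "has_velocity M S \<gamma> v t \<longleftrightarrow>
     \<gamma> t \<in> points M \<and> continuous (at t within S) \<gamma> \<and> v \<in> tangent_space M (\<gamma> t) \<and>
     (\<forall>c\<in>charts M. \<gamma> t \<in> cdom M c \<longrightarrow>
        ((cmap M c \<circ> \<gamma>) has_vector_derivative v c) (at t within S))"

definition velocity ::
  "('i, 'a::topological_space, 'e::euclidean_space) riemannian \<Rightarrow> real set \<Rightarrow> (real \<Rightarrow> 'a) \<Rightarrow>
   real \<Rightarrow> 'i \<Rightarrow> 'e" where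
  "velocity M S \<gamma> t = (THE v. has_velocity M S \<gamma> v t)"


section \<open>Length and intrinsic distance\<close>

definition C1_curve ::
  "('i, 'a::topological_space, 'e::euclidean_space) riemannian \<Rightarrow> real \<Rightarrow> real \<Rightarrow>
   (real \<Rightarrow> 'a) \<Rightarrow> bool" where
  "C1_curve M a b \<gamma> \<longleftrightarrow>
     (\<forall>t\<in>{a..b}. has_velocity M {a..b} \<gamma> (velocity M {a..b} \<gamma> t) t) \<and>
     (\<forall>c\<in>charts M. continuous_on {t\<in>{a..b}. \<gamma> t \<in> cdom M c} (\<lambda>t. velocity M {a..b} \<gamma> t c))"

text \<open>
  Curves on \<open>[0,1]\<close> that are \<open>C\<^sup>1\<close> up to the end points on each closed piece of a
  finite subdivision. (\<^const>\<open>piecewise_C1_differentiable_on\<close> would allow the derivative to blow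
  up at the break points, where the length integral need not exist.)
\<close>

definition piecewise_C1_curve ::
  "('i, 'a::topological_space, 'e::euclidean_space) riemannian \<Rightarrow> (real \<Rightarrow> 'a) \<Rightarrow> bool" where
  "piecewise_C1_curve M \<gamma> \<longleftrightarrow>
     (\<exists>(k::nat) \<tau>. \<tau> 0 = 0 \<and> \<tau> k = 1 \<and>
        (\<forall>j<k. \<tau> j < \<tau> (Suc j) \<and> C1_curve M (\<tau> j) (\<tau> (Suc j)) \<gamma>))"

text \<open>The finitely many break points, where \<^const>\<open>velocity\<close> is unspecified, do not affect the
  integral.\<close>

definition curve_length ::
  "('i, 'a::topological_space, 'e::euclidean_space) riemannian \<Rightarrow> (real \<Rightarrow> 'a) \<Rightarrow> real" where
  "curve_length M \<gamma> = integral {0..1} (\<lambda>t. riem_norm M (\<gamma> t) (velocity M {0..1} \<gamma> t))"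

definition riem_dist ::
  "('i, 'a::topological_space, 'e::euclidean_space) riemannian \<Rightarrow> 'a \<Rightarrow> 'a \<Rightarrow> real" where
  "riem_dist M p q =
     Inf {curve_length M \<gamma> | \<gamma>. piecewise_C1_curve M \<gamma> \<and> \<gamma> 0 = p \<and> \<gamma> 1 = q}"

text \<open>Metric completeness; equivalent to geodesic completeness by Hopf-Rinow.\<close>

definition complete_riemannian ::
  "('i, 'a::topological_space, 'e::euclidean_space) riemannian \<Rightarrow> bool" where
  "complete_riemannian M \<longleftrightarrow> Metric_space.mcomplete (points M) (riem_dist M)"


section \<open>Geodesics, geodesic convexity and the Riemannian logarithm\<close>

text \<open>
  Christoffel symbols of the first kind in the chart \<open>c\<close>, contracted with \<open>u\<close>, \<open>v\<close>,
  \<open>w\<close>: the inner product of \<open>w\<close> with \<open>\<Gamma>(u,v)\<close> is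
  \<open>(\<partial>\<^sub>u g(v,w) + \<partial>\<^sub>v g(u,w) - \<partial>\<^sub>w g(u,v)) / 2\<close>.
\<close>

definition christoffel ::
  "('i, 'a, 'e::euclidean_space) riemannian \<Rightarrow> 'i \<Rightarrow> 'e \<Rightarrow> 'e \<Rightarrow> 'e \<Rightarrow> 'e \<Rightarrow> real" where
  "christoffel M c q u v w =
     (frechet_derivative (\<lambda>q. coeff M c q v w) (at q) u +
      frechet_derivative (\<lambda>q. coeff M c q u w) (at q) v -
      frechet_derivative (\<lambda>q. coeff M c q u v) (at q) w) / 2"

text \<open>
  Geodesics on \<open>[0,1]\<close>, parametrized proportionally to arc length (constant curves included).
  In each chart the geodesic equation \<open>x'' + \<Gamma>(x',x') = 0\<close> is required after pairing it
  with an arbitrary vector \<open>w\<close> by the (nondegenerate) metric.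
\<close>

definition geodesic ::
  "('i, 'a::topological_space, 'e::euclidean_space) riemannian \<Rightarrow> (real \<Rightarrow> 'a) \<Rightarrow> bool" where
  "geodesic M \<gamma> \<longleftrightarrow>
     (\<forall>t\<in>{0..1}. has_velocity M {0..1} \<gamma> (velocity M {0..1} \<gamma> t) t \<and>
        (\<forall>c\<in>charts M. \<gamma> t \<in> cdom M c \<longrightarrow>
          (\<exists>A. ((\<lambda>s. velocity M {0..1} \<gamma> s c) has_vector_derivative A) (at t within {0..1}) \<and>
             (\<forall>w. coeff M c (cmap M c (\<gamma> t)) A w +
                  christoffel M c (cmap M c (\<gamma> t))
                    (velocity M {0..1} \<gamma> t c) (velocity M {0..1} \<gamma> t c) w = 0))))"

definition minimizing_geodesic ::
  "('i, 'a::topological_space, 'e::euclidean_space) riemannian \<Rightarrow> 'a \<Rightarrow> 'a \<Rightarrow> (real \<Rightarrow> 'a) \<Rightarrow> bool"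
  where
  "minimizing_geodesic M p q \<gamma> \<longleftrightarrow>
     geodesic M \<gamma> \<and> \<gamma> 0 = p \<and> \<gamma> 1 = q \<and> curve_length M \<gamma> = riem_dist M p q"

text \<open>Uniqueness is among all minimizing geodesics of the whole manifold.\<close>

definition geodesically_convex ::
  "('i, 'a::topological_space, 'e::euclidean_space) riemannian \<Rightarrow> 'a set \<Rightarrow> bool" where
  "geodesically_convex M U \<longleftrightarrow>
     U \<subseteq> points M \<and>
     (\<forall>p\<in>U. \<forall>q\<in>U. \<exists>\<gamma>. minimizing_geodesic M p q \<gamma> \<and> \<gamma> ` {0..1} \<subseteq> U \<and>
        (\<forall>\<gamma>'. minimizing_geodesic M p q \<gamma>' \<longrightarrow> (\<forall>t\<in>{0..1}. \<gamma>' t = \<gamma> t)))"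

text \<open>
  The vector \<open>v\<close> at \<open>p\<close> such that the geodesic \<open>t \<mapsto> exp\<^sub>p(t v)\<close>, \<open>t \<in> [0,1]\<close>,
  is minimizing and ends at \<open>exp\<^sub>p(v) = q\<close>.
\<close>

definition riem_log ::
  "('i, 'a::topological_space, 'e::euclidean_space) riemannian \<Rightarrow> 'a \<Rightarrow> 'a \<Rightarrow> 'i \<Rightarrow> 'e" where
  "riem_log M p q =
     (THE v. \<exists>\<gamma>. minimizing_geodesic M p q \<gamma> \<and> has_velocity M {0..1} \<gamma> v 0)"


section \<open>The discrete aggregation system\<close>

text \<open>The \<open>n\<close> particles are indexed by \<open>{1..n}\<close>; at time \<open>0\<close> the derivative is one-sided.\<close>

definition global_solution ::
  "('i, 'a::topological_space, 'e::euclidean_space) riemannian \<Rightarrow> 'a set \<Rightarrow> nat \<Rightarrow>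
   (nat \<Rightarrow> 'a) \<Rightarrow> (nat \<Rightarrow> real \<Rightarrow> 'a) \<Rightarrow> bool" where
  "global_solution M U n x0 x \<longleftrightarrow>
     (\<forall>i\<in>{1..n}. x i 0 = x0 i \<and>
        (\<forall>t\<ge>0. x i t \<in> U \<and>
           has_velocity M {0..} (x i)
             (\<lambda>c. (1 / real n) *\<^sub>R (\<Sum>j\<in>{1..n}. riem_log M (x i t) (x j t) c)) t))"

definition unique_global_solution ::
  "('i, 'a::topological_space, 'e::euclidean_space) riemannian \<Rightarrow> 'a set \<Rightarrow> nat \<Rightarrow>
   (nat \<Rightarrow> 'a) \<Rightarrow> (nat \<Rightarrow> real \<Rightarrow> 'a) \<Rightarrow> bool" where
  "unique_global_solution M U n x0 x \<longleftrightarrow>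
     global_solution M U n x0 x \<and>
     (\<forall>x'. global_solution M U n x0 x' \<longrightarrow> (\<forall>i\<in>{1..n}. \<forall>t\<ge>0. x' i t = x i t))"

end

theory Submission
  imports Defs
begin

text \<open>The distance of the product satisfies \<open>d\<^sup>2 = d\<^sub>1\<^sup>2 + d\<^sub>2\<^sup>2\<close> and its logarithm is
  \<open>(log, log)\<close> for points of \<open>U\<^sub>1 \<times> U\<^sub>2\<close>. The second fact decouples the system on the product:
  its solutions are exactly the pairs of solutions of the two factors (\<open>global_solution_Pair\<close>,
  \<open>global_solution_prodD\<close>), so existence and uniqueness are inherited. The first one then turns
  convergence of the distances in the factors into convergence of \<open>d\<close>.

  Distances and logarithms are defined by an infimum of lengths and by the initial velocity of a
  minimizing geodesic, so both facts have to be derived from the product metric. Three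
  observations suffice.

  A velocity of the product is a pair of velocities, and its squared norm is the sum of the squared
  norms (\<open>has_velocity_prodE\<close>, \<open>riem_norm_prod\<close>). Hence a curve of the product with components of
  length \<open>L\<^sub>1\<close>, \<open>L\<^sub>2\<close> has length at least \<open>sqrt (L\<^sub>1\<^sup>2 + L\<^sub>2\<^sup>2)\<close>, by the integral triangle inequality
  (\<open>curve_length_prod_ge\<close>).

  The Christoffel symbols of the product have no mixed terms, so a curve is a geodesic if and only
  if both components are (\<open>geodesic_Pair\<close>, \<open>geodesic_prodD\<close>). Geodesics have constant speed
  (\<open>geodesic_constant_speed\<close>), so for them the length is exactly \<open>sqrt (L\<^sub>1\<^sup>2 + L\<^sub>2\<^sup>2)\<close>.

  Together these show that the product of minimizing geodesics is minimizing, which gives the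
  formula for \<open>d\<close>, and that a minimizing geodesic of the product between the same points has
  minimizing components (\<open>riem_dist_prod\<close>, \<open>minimizing_geodesic_prodD\<close>). By convexity the
  latter are unique, so the logarithm of the product is well defined and is the pair of the logarithms
  (\<open>riem_log_prod\<close>).\<close>

section \<open>Charts and metric coefficients\<close>

lemma manifold_chartD:
  assumes "riemannian_manifold M" and "c \<in> charts M"
  shows "open (cdom M c)" and "open (cmap M c ` cdom M c)"
    and "inj_on (cmap M c) (cdom M c)" and "continuous_on (cdom M c) (cmap M c)"
proof -
  have *: "open (cdom M c) \<and> open (cmap M c ` cdom M c) \<and>
        homeomorphism (cdom M c) (cmap M c ` cdom M c) (cmap M c)
          (inv_into (cdom M c) (cmap M c))"
    using assms unfolding riemannian_manifold_def by blast
  then show "open (cdom M c)" "open (cmap M c ` cdom M c)" by auto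
  from * have h: "homeomorphism (cdom M c) (cmap M c ` cdom M c) (cmap M c)
          (inv_into (cdom M c) (cmap M c))" by blast
  then show "continuous_on (cdom M c) (cmap M c)" by (simp add: homeomorphism_def)
  from h have "\<And>p. p \<in> cdom M c \<Longrightarrow> inv_into (cdom M c) (cmap M c) (cmap M c p) = p"
    by (simp add: homeomorphism_def)
  then show "inj_on (cmap M c) (cdom M c)" by (rule inj_on_inverseI)
qed

lemma smooth_on_differentiable: "smooth_on S f \<Longrightarrow> q \<in> S \<Longrightarrow> f differentiable (at q)"
  unfolding smooth_on_def by (metis Ck_on.simps(2))

lemma smooth_on_continuous: "smooth_on S f \<Longrightarrow> continuous_on S f"
  unfolding smooth_on_def by (metis Ck_on.simps(1))

lemma transition_differentiable:
  assumes "riemannian_manifold M" "c \<in> charts M" "c' \<in> charts M" "p \<in> cdom M c" "p \<in> cdom M c'"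
  shows "transition M c c' differentiable (at (cmap M c p))"
  by (rule smooth_on_differentiable[of "cmap M c ` (cdom M c \<inter> cdom M c')"])
     (use assms in \<open>auto simp: riemannian_manifold_def\<close>)

lemma coeff_differentiable:
  assumes "riemannian_manifold M" "c \<in> charts M" "q \<in> cmap M c ` cdom M c"
  shows "(\<lambda>q. coeff M c q u v) differentiable (at q)"
  by (rule smooth_on_differentiable[of "cmap M c ` cdom M c"])
     (use assms in \<open>auto simp: riemannian_manifold_def\<close>)

lemma coeff_continuous_on:
  assumes "riemannian_manifold M" "c \<in> charts M"
  shows "continuous_on (cmap M c ` cdom M c) (\<lambda>q. coeff M c q u v)"
  by (rule smooth_on_continuous) (use assms in \<open>auto simp: riemannian_manifold_def\<close>)

lemma coeff_bilinear:
  assumes "riemannian_manifold M" "c \<in> charts M" "q \<in> cmap M c ` cdom M c"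
  shows "bilinear (coeff M c q)"
  using assms unfolding riemannian_manifold_def by blast

lemma coeff_sym:
  assumes "riemannian_manifold M" "c \<in> charts M" "q \<in> cmap M c ` cdom M c"
  shows "coeff M c q u v = coeff M c q v u"
  using assms unfolding riemannian_manifold_def by blast

lemma coeff_nonneg:
  assumes "riemannian_manifold M" "c \<in> charts M" "q \<in> cmap M c ` cdom M c"
  shows "coeff M c q u u \<ge> 0"
proof (cases "u = 0")
  case True
  then show ?thesis using bilinear_lzero[OF coeff_bilinear[OF assms]] by simp
next
  case False
  then show ?thesis using assms unfolding riemannian_manifold_def
    by (meson less_imp_le)
qed

lemma coeff_transform:
  assumes "riemannian_manifold M" "c \<in> charts M" "c' \<in> charts M" "p \<in> cdom M c" "p \<in> cdom M c'"
  shows "coeff M c (cmap M c p) u v = coeff M c' (cmap M c' p)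
          (frechet_derivative (transition M c c') (at (cmap M c p)) u)
          (frechet_derivative (transition M c c') (at (cmap M c p)) v)"
  using assms unfolding riemannian_manifold_def by blast

section \<open>Tangent vectors and velocities\<close>

lemma tangent_space_zero:
  "v \<in> tangent_space M p \<Longrightarrow> \<not> (c \<in> charts M \<and> p \<in> cdom M c) \<Longrightarrow> v c = 0"
  unfolding tangent_space_def by blast

lemma tangent_space_transition:
  "v \<in> tangent_space M p \<Longrightarrow> c \<in> charts M \<Longrightarrow> c' \<in> charts M \<Longrightarrow> p \<in> cdom M c \<Longrightarrow> p \<in> cdom M c' \<Longrightarrow>
    v c' = frechet_derivative (transition M c c') (at (cmap M c p)) (v c)"
  unfolding tangent_space_def by blast

lemma has_velocityD:
  assumes "has_velocity M S \<gamma> v t"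
  shows "\<gamma> t \<in> points M" "continuous (at t within S) \<gamma>" "v \<in> tangent_space M (\<gamma> t)"
    "\<And>c. c \<in> charts M \<Longrightarrow> \<gamma> t \<in> cdom M c \<Longrightarrow>
        ((cmap M c \<circ> \<gamma>) has_vector_derivative v c) (at t within S)"
  using assms unfolding has_velocity_def by auto

lemma has_velocity_unique:
  assumes "has_velocity M S \<gamma> v t" "has_velocity M S \<gamma> w t" "at t within S \<noteq> bot"
  shows "v = w"
proof
  fix c
  show "v c = w c"
  proof (cases "c \<in> charts M \<and> \<gamma> t \<in> cdom M c")
    case True
    then show ?thesis
      using has_velocityD(4)[OF assms(1)] has_velocityD(4)[OF assms(2)] assms(3)
      by (blast intro: vector_derivative_unique_within)
  next
    case False
    then show ?thesis
      using tangent_space_zero has_velocityD(3)[OF assms(1)] has_velocityD(3)[OF assms(2)] by metis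
  qed
qed

lemma velocity_eqI:
  assumes "has_velocity M S \<gamma> v t" "at t within S \<noteq> bot"
  shows "velocity M S \<gamma> t = v"
  unfolding velocity_def using has_velocity_unique assms by blast

text \<open>Agreement on the set of times suffices, because nothing else enters a velocity relative to it. Two
  minimizing geodesics are only known to agree on \<open>[0,1]\<close>.\<close>

lemma has_velocity_transform:
  assumes "has_velocity M S \<gamma> v t" "\<And>s. s \<in> S \<Longrightarrow> \<gamma>' s = \<gamma> s" "t \<in> S"
  shows "has_velocity M S \<gamma>' v t"
  unfolding has_velocity_def
proof (intro conjI ballI impI)
  have eq: "\<gamma>' t = \<gamma> t" using assms by auto
  show "\<gamma>' t \<in> points M" "v \<in> tangent_space M (\<gamma>' t)"
    using has_velocityD[OF assms(1)] eq by auto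
  show "continuous (at t within S) \<gamma>'"
    using has_velocityD(2)[OF assms(1)]
    unfolding continuous_within eq
    by (rule Lim_transform_eventually) (auto simp: eventually_at_filter assms(2))
  fix c assume "c \<in> charts M" "\<gamma>' t \<in> cdom M c"
  then have "((cmap M c \<circ> \<gamma>) has_vector_derivative v c) (at t within S)"
    using has_velocityD(4)[OF assms(1)] eq by auto
  then show "((cmap M c \<circ> \<gamma>') has_vector_derivative v c) (at t within S)"
    by (rule has_vector_derivative_transform[rotated 2]) (use assms in auto)
qed

section \<open>Tangent vectors and velocities of a product\<close>

lemma riem_prod_simps [simp]:
  "charts (riem_prod M N) = charts M \<times> charts N"
  "cdom (riem_prod M N) (c, d) = cdom M c \<times> cdom N d"
  "cmap (riem_prod M N) (c, d) = map_prod (cmap M c) (cmap N d)"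
  "coeff (riem_prod M N) (c, d) q u v =
     coeff M c (fst q) (fst u) (fst v) + coeff N d (snd q) (snd u) (snd v)"
  by (auto simp: riem_prod_def)

lemma points_riem_prod [simp]: "points (riem_prod M N) = points M \<times> points N"
  unfolding points_def by auto

text \<open>The coordinate map of the product chart is inverted componentwise, so on the image of the product
  chart, which is open, the transition map is the product of the transition maps of the factors.\<close>

lemma frechet_derivative_transition_prod:
  assumes M: "riemannian_manifold M" "c \<in> charts M" "c' \<in> charts M" "p \<in> cdom M c" "p \<in> cdom M c'"
    and N: "riemannian_manifold N" "d \<in> charts N" "d' \<in> charts N" "q \<in> cdom N d" "q \<in> cdom N d'"
  shows "frechet_derivative (transition (riem_prod M N) (c, d) (c', d'))
           (at (cmap M c p, cmap N d q)) (u, v) =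
         (frechet_derivative (transition M c c') (at (cmap M c p)) u,
          frechet_derivative (transition N d d') (at (cmap N d q)) v)"
proof -
  let ?T = "transition M c c'" and ?T' = "transition N d d'"
  let ?P = "cmap M c ` cdom M c \<times> cmap N d ` cdom N d"
  have 1: "(?T has_derivative frechet_derivative ?T (at (cmap M c p))) (at (fst (cmap M c p, cmap N d q)))"
    using transition_differentiable[OF M] by (simp add: frechet_derivative_works)
  have 2: "(?T' has_derivative frechet_derivative ?T' (at (cmap N d q))) (at (snd (cmap M c p, cmap N d q)))"
    using transition_differentiable[OF N] by (simp add: frechet_derivative_works)
  have 3: "((\<lambda>z. (?T (fst z), ?T' (snd z))) has_derivative
     (\<lambda>h. (frechet_derivative ?T (at (cmap M c p)) (fst h),
           frechet_derivative ?T' (at (cmap N d q)) (snd h)))) (at (cmap M c p, cmap N d q))"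
    by (intro has_derivative_Pair has_derivative_compose[OF has_derivative_fst[OF has_derivative_ident] 1]
          has_derivative_compose[OF has_derivative_snd[OF has_derivative_ident] 2])
  have "open ?P" using manifold_chartD(2)[OF M(1,2)] manifold_chartD(2)[OF N(1,2)] by (rule open_Times)
  moreover have "(cmap M c p, cmap N d q) \<in> ?P" using M N by auto
  moreover have "(?T (fst z), ?T' (snd z)) = transition (riem_prod M N) (c, d) (c', d') z" if z: "z \<in> ?P" for z
  proof -
    obtain a where a: "a \<in> cdom M c" "fst z = cmap M c a"
      using z unfolding mem_Times_iff by blast
    obtain b where b: "b \<in> cdom N d" "snd z = cmap N d b"
      using z unfolding mem_Times_iff by blast
    have ab: "a \<in> cdom M c" "b \<in> cdom N d" "z = (cmap M c a, cmap N d b)"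
      using a b by (simp_all add: prod_eq_iff)
    have i1: "inj_on (cmap M c) (cdom M c)" and i2: "inj_on (cmap N d) (cdom N d)"
      using manifold_chartD(3)[OF M(1,2)] manifold_chartD(3)[OF N(1,2)] by simp_all
    then have "inj_on (map_prod (cmap M c) (cmap N d)) (cdom M c \<times> cdom N d)"
      by (auto intro!: inj_onI dest: inj_onD)
    then have "inv_into (cdom M c \<times> cdom N d) (map_prod (cmap M c) (cmap N d)) z = (a, b)"
      using inv_into_f_f[of "map_prod (cmap M c) (cmap N d)" "cdom M c \<times> cdom N d" "(a, b)"] ab by auto
    then show ?thesis using ab i1 i2 by (simp add: transition_def)
  qed
  ultimately have "(transition (riem_prod M N) (c, d) (c', d') has_derivative
     (\<lambda>h. (frechet_derivative ?T (at (cmap M c p)) (fst h),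
           frechet_derivative ?T' (at (cmap N d q)) (snd h)))) (at (cmap M c p, cmap N d q))"
    by (rule has_derivative_transform_within_open[OF 3])
  from frechet_derivative_at[OF this, symmetric] show ?thesis by simp
qed

lemma frechet_derivative_transition_self:
  assumes M: "riemannian_manifold M" "c \<in> charts M" "p \<in> cdom M c"
  shows "frechet_derivative (transition M c c) (at (cmap M c p)) u = u"
proof -
  have "(transition M c c has_derivative (\<lambda>h. h)) (at (cmap M c p))"
  proof (rule has_derivative_transform_within_open[OF has_derivative_ident manifold_chartD(2)[OF M(1,2)]])
    show "cmap M c p \<in> cmap M c ` cdom M c" using M(3) by (rule imageI)
    show "q = transition M c c q" if "q \<in> cmap M c ` cdom M c" for q
      using f_inv_into_f[OF that] by (simp add: transition_def)
  qed
  from frechet_derivative_at[OF this, symmetric] show ?thesis by simp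
qed

text \<open>The identification of \<open>T\<^sub>pM \<times> T\<^sub>qN\<close> with the tangent space of the product. A pair of charts
  in which only one of the two is defined at its point is not a chart around \<open>(p, q)\<close>; there the
  value has to be \<open>0\<close>, by the convention for tangent vectors.\<close>

definition prod_tangent ::
  "('i, 'a, 'e::euclidean_space) riemannian \<Rightarrow> ('j, 'b, 'f::euclidean_space) riemannian \<Rightarrow>
   'a \<Rightarrow> 'b \<Rightarrow> ('i \<Rightarrow> 'e) \<Rightarrow> ('j \<Rightarrow> 'f) \<Rightarrow> 'i \<times> 'j \<Rightarrow> 'e \<times> 'f" where
  "prod_tangent M N p q v w =
     (\<lambda>(c, d). if (c \<in> charts M \<and> p \<in> cdom M c) \<and> d \<in> charts N \<and> q \<in> cdom N d then (v c, w d) else 0)"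

lemma prod_tangent_chart [simp]:
  "c \<in> charts M \<Longrightarrow> p \<in> cdom M c \<Longrightarrow> d \<in> charts N \<Longrightarrow> q \<in> cdom N d \<Longrightarrow>
    prod_tangent M N p q v w (c, d) = (v c, w d)"
  by (simp add: prod_tangent_def)

lemma prod_tangent_in_tangent_space:
  assumes M: "riemannian_manifold M" and N: "riemannian_manifold N"
    and v: "v \<in> tangent_space M p" and w: "w \<in> tangent_space N q"
  shows "prod_tangent M N p q v w \<in> tangent_space (riem_prod M N) (p, q)"
  unfolding tangent_space_def mem_Collect_eq
proof (intro conjI allI impI ballI)
  fix e assume "\<not> (e \<in> charts (riem_prod M N) \<and> (p, q) \<in> cdom (riem_prod M N) e)"
  then show "prod_tangent M N p q v w e = 0"
    by (cases e) (auto simp: prod_tangent_def)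
next
  fix e e'
  assume *: "e \<in> charts (riem_prod M N)" "e' \<in> charts (riem_prod M N)"
    "(p, q) \<in> cdom (riem_prod M N) e" "(p, q) \<in> cdom (riem_prod M N) e'"
  obtain c d c' d' where e: "e = (c, d)" "e' = (c', d')" by (meson prod.exhaust)
  show "prod_tangent M N p q v w e' = frechet_derivative (transition (riem_prod M N) e e')
           (at (cmap (riem_prod M N) e (p, q))) (prod_tangent M N p q v w e)"
    using * frechet_derivative_transition_prod[of M c c' p N d d' q] M N
      tangent_space_transition[OF v, of c c'] tangent_space_transition[OF w, of d d']
    unfolding e by simp
qed

text \<open>Only the values in charts around \<open>p\<close> and \<open>q\<close> survive in the product, whence the assumption on
  the other indices; it holds for tangent vectors and for linear combinations of them alike.\<close>

lemma prod_tangent_inject: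
  assumes p: "p \<in> points M" and q: "q \<in> points N"
    and v: "\<And>c. \<not> (c \<in> charts M \<and> p \<in> cdom M c) \<Longrightarrow> v c = v' c"
    and w: "\<And>d. \<not> (d \<in> charts N \<and> q \<in> cdom N d) \<Longrightarrow> w d = w' d"
    and eq: "prod_tangent M N p q v w = prod_tangent M N p q v' w'"
  shows "v = v'" "w = w'"
proof -
  obtain c0 d0 where cd: "c0 \<in> charts M" "p \<in> cdom M c0" "d0 \<in> charts N" "q \<in> cdom N d0"
    using p q unfolding points_def by blast
  show "v = v'"
  proof
    fix c show "v c = v' c"
      using fun_cong[OF eq, of "(c, d0)"] v[of c] cd
      by (cases "c \<in> charts M \<and> p \<in> cdom M c") auto
  qed
  show "w = w'"
  proof
    fix d show "w d = w' d"
      using fun_cong[OF eq, of "(c0, d)"] w[of d] cd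
      by (cases "d \<in> charts N \<and> q \<in> cdom N d") auto
  qed
qed

text \<open>The components are read off with the help of one fixed chart around the point of the other
  factor. The choice does not matter: changing that chart leaves the chart of the first factor
  alone, and the transition of a chart to itself has the identity as its differential.\<close>

lemma tangent_space_prodE:
  fixes M :: "('i, 'a::{t2_space,second_countable_topology}, 'e::euclidean_space) riemannian"
    and N :: "('j, 'b::{t2_space,second_countable_topology}, 'f::euclidean_space) riemannian"
  assumes M: "riemannian_manifold M" and N: "riemannian_manifold N"
    and p: "p \<in> points M" and q: "q \<in> points N"
    and V: "V \<in> tangent_space (riem_prod M N) (p, q)"
  obtains v w where "v \<in> tangent_space M p" "w \<in> tangent_space N q" "V = prod_tangent M N p q v w"
proof -
  obtain c0 d0 where cd: "c0 \<in> charts M" "p \<in> cdom M c0" "d0 \<in> charts N" "q \<in> cdom N d0"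
    using p q unfolding points_def by blast
  define v where "v = (\<lambda>c. if c \<in> charts M \<and> p \<in> cdom M c then fst (V (c, d0)) else 0)"
  define w where "w = (\<lambda>d. if d \<in> charts N \<and> q \<in> cdom N d then snd (V (c0, d)) else 0)"
  have tr: "fst (V (c', d')) = frechet_derivative (transition M c c') (at (cmap M c p)) (fst (V (c, d)))"
      "snd (V (c', d')) = frechet_derivative (transition N d d') (at (cmap N d q)) (snd (V (c, d)))"
    if "c \<in> charts M" "p \<in> cdom M c" "c' \<in> charts M" "p \<in> cdom M c'"
       "d \<in> charts N" "q \<in> cdom N d" "d' \<in> charts N" "q \<in> cdom N d'" for c c' d d'
    using tangent_space_transition[OF V, of "(c, d)" "(c', d')"]
      frechet_derivative_transition_prod[of M c c' p N d d' q "fst (V (c, d))" "snd (V (c, d))"] that M N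
    by simp_all
  have "v \<in> tangent_space M p"
    unfolding tangent_space_def mem_Collect_eq
  proof (intro conjI allI ballI impI)
    fix c c' assume "c \<in> charts M" "c' \<in> charts M" "p \<in> cdom M c" "p \<in> cdom M c'"
    then show "v c' = frechet_derivative (transition M c c') (at (cmap M c p)) (v c)"
      unfolding v_def using tr(1)[of c c' d0 d0] cd by (simp only: if_True simp_thms)
  qed (auto simp: v_def)
  moreover have "w \<in> tangent_space N q"
    unfolding tangent_space_def mem_Collect_eq
  proof (intro conjI allI ballI impI)
    fix d d' assume "d \<in> charts N" "d' \<in> charts N" "q \<in> cdom N d" "q \<in> cdom N d'"
    then show "w d' = frechet_derivative (transition N d d') (at (cmap N d q)) (w d)"
      unfolding w_def using tr(2)[of c0 c0 d d'] cd by (simp only: if_True simp_thms)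
  qed (auto simp: w_def)
  moreover have "V = prod_tangent M N p q v w"
  proof
    fix e :: "'i \<times> 'j"
    obtain c d where e: "e = (c, d)" by (cases e)
    show "V e = prod_tangent M N p q v w e"
    proof (cases "(c \<in> charts M \<and> p \<in> cdom M c) \<and> d \<in> charts N \<and> q \<in> cdom N d")
      case True
      \<comment> \<open>independence of the auxiliary chart of the other factor: the transition from \<open>c\<close> to
        \<open>c\<close> is the identity\<close>
      have "fst (V (c, d)) = fst (V (c, d0))" "snd (V (c, d)) = snd (V (c0, d))"
        using tr(1)[of c c d0 d] tr(2)[of c0 c d d] True cd M N
        by (auto simp: frechet_derivative_transition_self)
      then show ?thesis using True by (simp add: e v_def w_def prod_eq_iff)
    next
      case False
      then show ?thesis using tangent_space_zero[OF V, of e] by (auto simp: e prod_tangent_def)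
    qed
  qed
  ultimately show ?thesis using that by blast
qed

lemma has_velocity_Pair:
  assumes M: "riemannian_manifold M" and N: "riemannian_manifold N"
    and v: "has_velocity M S \<alpha> v t" and w: "has_velocity N S \<beta> w t"
  shows "has_velocity (riem_prod M N) S (\<lambda>t. (\<alpha> t, \<beta> t)) (prod_tangent M N (\<alpha> t) (\<beta> t) v w) t"
  unfolding has_velocity_def
proof (intro conjI ballI impI)
  show "(\<alpha> t, \<beta> t) \<in> points (riem_prod M N)"
    using has_velocityD(1)[OF v] has_velocityD(1)[OF w] by simp
  show "continuous (at t within S) (\<lambda>t. (\<alpha> t, \<beta> t))"
    using has_velocityD(2)[OF v] has_velocityD(2)[OF w] by (rule continuous_Pair)
  show "prod_tangent M N (\<alpha> t) (\<beta> t) v w \<in> tangent_space (riem_prod M N) (\<alpha> t, \<beta> t)"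
    using has_velocityD(3)[OF v] has_velocityD(3)[OF w] M N by (simp add: prod_tangent_in_tangent_space)
  fix e assume e: "e \<in> charts (riem_prod M N)" "(\<alpha> t, \<beta> t) \<in> cdom (riem_prod M N) e"
  obtain c d where cd: "e = (c, d)" by (cases e)
  have "((\<lambda>t. ((cmap M c \<circ> \<alpha>) t, (cmap N d \<circ> \<beta>) t)) has_vector_derivative (v c, w d)) (at t within S)"
    by (intro has_vector_derivative_Pair has_velocityD(4)[OF v] has_velocityD(4)[OF w])
      (use e cd in auto)
  then show "((cmap (riem_prod M N) e \<circ> (\<lambda>t. (\<alpha> t, \<beta> t))) has_vector_derivative
      prod_tangent M N (\<alpha> t) (\<beta> t) v w e) (at t within S)"
    using e cd by (simp add: o_def)
qed

lemma has_velocity_prodE: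
  assumes M: "riemannian_manifold M" and N: "riemannian_manifold N"
    and V: "has_velocity (riem_prod M N) S \<gamma> V t"
  obtains v w where "has_velocity M S (fst \<circ> \<gamma>) v t" "has_velocity N S (snd \<circ> \<gamma>) w t"
    "V = prod_tangent M N (fst (\<gamma> t)) (snd (\<gamma> t)) v w"
proof -
  define p q where "p = fst (\<gamma> t)" and "q = snd (\<gamma> t)"
  have pq: "p \<in> points M" "q \<in> points N"
    using has_velocityD(1)[OF V] by (auto simp: p_def q_def mem_Times_iff)
  obtain c0 d0 where cd: "c0 \<in> charts M" "p \<in> cdom M c0" "d0 \<in> charts N" "q \<in> cdom N d0"
    using pq unfolding points_def by blast
  have "V \<in> tangent_space (riem_prod M N) (p, q)"
    using has_velocityD(3)[OF V] by (simp add: p_def q_def)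
  then obtain v w where vw: "v \<in> tangent_space M p" "w \<in> tangent_space N q"
      "V = prod_tangent M N p q v w"
    using tangent_space_prodE M N pq by blast
  have der: "((cmap M c \<circ> (fst \<circ> \<gamma>)) has_vector_derivative v c) (at t within S)"
      "((cmap N d \<circ> (snd \<circ> \<gamma>)) has_vector_derivative w d) (at t within S)"
    if "c \<in> charts M" "p \<in> cdom M c" "d \<in> charts N" "q \<in> cdom N d" for c d
  proof -
    have *: "((cmap (riem_prod M N) (c, d) \<circ> \<gamma>) has_vector_derivative (v c, w d)) (at t within S)"
      using has_velocityD(4)[OF V, of "(c, d)"] that vw(3) by (auto simp: p_def q_def mem_Times_iff)
    from bounded_linear.has_vector_derivative[OF bounded_linear_fst this]
    show "((cmap M c \<circ> (fst \<circ> \<gamma>)) has_vector_derivative v c) (at t within S)"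
      by (simp add: o_def)
    from bounded_linear.has_vector_derivative[OF bounded_linear_snd *]
    show "((cmap N d \<circ> (snd \<circ> \<gamma>)) has_vector_derivative w d) (at t within S)"
      by (simp add: o_def)
  qed
  have "has_velocity M S (fst \<circ> \<gamma>) v t" "has_velocity N S (snd \<circ> \<gamma>) w t"
    using has_velocityD(2)[OF V] pq vw der cd unfolding has_velocity_def
    by (auto simp: p_def q_def o_def intro: continuous_fst continuous_snd)
  then show ?thesis using that vw(3) by (simp add: p_def q_def)
qed

text \<open>At a non-isolated time velocities are unique, so the splitting of a velocity of the product is the
  one into the velocities of the two components.\<close>

lemma velocity_prod:
  assumes M: "riemannian_manifold M" and N: "riemannian_manifold N"
    and V: "has_velocity (riem_prod M N) S \<gamma> V t" and t: "at t within S \<noteq> bot"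
  shows "has_velocity M S (fst \<circ> \<gamma>) (velocity M S (fst \<circ> \<gamma>) t) t"
    and "has_velocity N S (snd \<circ> \<gamma>) (velocity N S (snd \<circ> \<gamma>) t) t"
    and "velocity (riem_prod M N) S \<gamma> t =
      prod_tangent M N (fst (\<gamma> t)) (snd (\<gamma> t)) (velocity M S (fst \<circ> \<gamma>) t) (velocity N S (snd \<circ> \<gamma>) t)"
proof -
  obtain v w where vw: "has_velocity M S (fst \<circ> \<gamma>) v t" "has_velocity N S (snd \<circ> \<gamma>) w t"
    "V = prod_tangent M N (fst (\<gamma> t)) (snd (\<gamma> t)) v w"
    by (rule has_velocity_prodE[OF M N V])
  show "has_velocity M S (fst \<circ> \<gamma>) (velocity M S (fst \<circ> \<gamma>) t) t"
    "has_velocity N S (snd \<circ> \<gamma>) (velocity N S (snd \<circ> \<gamma>) t) t"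
    "velocity (riem_prod M N) S \<gamma> t =
      prod_tangent M N (fst (\<gamma> t)) (snd (\<gamma> t)) (velocity M S (fst \<circ> \<gamma>) t) (velocity N S (snd \<circ> \<gamma>) t)"
    using vw velocity_eqI[OF V t] velocity_eqI[OF vw(1) t] velocity_eqI[OF vw(2) t] by simp_all
qed

section \<open>Norms of tangent vectors and speeds of curves\<close>

lemma obtain_chart:
  assumes "p \<in> points M"
  obtains c where "c \<in> charts M" "p \<in> cdom M c"
  using assms unfolding points_def by blast

text \<open>For arbitrary families \<open>u\<close>, \<open>v\<close>, tangent or not: the velocity at a break point of a curve is
  unspecified, and lengths must be handled there too.\<close>

lemma riem_inner_some_chart:
  assumes "p \<in> points M"
  obtains c where "c \<in> charts M" "p \<in> cdom M c"
    "\<And>u v. riem_inner M p u v = coeff M c (cmap M c p) (u c) (v c)"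
proof -
  let ?c = "SOME c. c \<in> charts M \<and> p \<in> cdom M c"
  have "?c \<in> charts M \<and> p \<in> cdom M ?c"
    by (rule someI_ex) (use assms in \<open>auto simp: points_def\<close>)
  then show ?thesis by (intro that[of ?c]) (simp_all add: riem_inner_def Let_def)
qed

lemma riem_inner_chart:
  assumes M: "riemannian_manifold M" and c: "c \<in> charts M" "p \<in> cdom M c"
    and v: "v \<in> tangent_space M p" and w: "w \<in> tangent_space M p"
  shows "riem_inner M p v w = coeff M c (cmap M c p) (v c) (w c)"
proof -
  have "p \<in> points M" using c unfolding points_def by blast
  then obtain c' where c': "c' \<in> charts M" "p \<in> cdom M c'"
    "riem_inner M p v w = coeff M c' (cmap M c' p) (v c') (w c')"
    using riem_inner_some_chart by metis
  then show ?thesis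
    using coeff_transform[OF M c(1) c'(1) c(2) c'(2), of "v c" "w c"]
      tangent_space_transition[OF v c(1) c'(1) c(2) c'(2)]
      tangent_space_transition[OF w c(1) c'(1) c(2) c'(2)] by simp
qed

lemma riem_inner_nonneg:
  assumes "riemannian_manifold M" "p \<in> points M"
  shows "riem_inner M p v v \<ge> 0"
  using riem_inner_some_chart[OF assms(2)] coeff_nonneg[OF assms(1)] by (metis imageI)

lemma riem_norm_nonneg:
  assumes "riemannian_manifold M" "p \<in> points M"
  shows "riem_norm M p v \<ge> 0"
  using riem_inner_nonneg[OF assms] by (simp add: riem_norm_def)

text \<open>The coefficients of the product metric are sums, so the squared norms add up; the norm of either
  factor may be computed in its part of the chart that the product happens to use.\<close>

lemma riem_norm_prod:
  assumes M: "riemannian_manifold M" "p \<in> points M" "v \<in> tangent_space M p"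
    and N: "riemannian_manifold N" "q \<in> points N" "w \<in> tangent_space N q"
  shows "riem_norm (riem_prod M N) (p, q) (prod_tangent M N p q v w) =
    sqrt ((riem_norm M p v)\<^sup>2 + (riem_norm N q w)\<^sup>2)"
proof -
  have "(p, q) \<in> points (riem_prod M N)" using M N by simp
  then obtain e where e: "e \<in> charts (riem_prod M N)" "(p, q) \<in> cdom (riem_prod M N) e"
    "\<And>u v. riem_inner (riem_prod M N) (p, q) u v =
      coeff (riem_prod M N) e (cmap (riem_prod M N) e (p, q)) (u e) (v e)"
    by (rule riem_inner_some_chart) blast
  obtain c d where "e = (c, d)" by (cases e)
  then have "riem_inner (riem_prod M N) (p, q) (prod_tangent M N p q v w) (prod_tangent M N p q v w)
      = riem_inner M p v v + riem_inner N q w w"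
    using e riem_inner_chart[OF M(1) _ _ M(3) M(3), of c] riem_inner_chart[OF N(1) _ _ N(3) N(3), of d]
    by simp
  then show ?thesis
    using riem_inner_nonneg[OF M(1,2)] riem_inner_nonneg[OF N(1,2)] by (simp add: riem_norm_def)
qed

text \<open>Regularity of the metric is given for fixed vectors only. This expansion turns it into joint
  regularity in the base point and the vectors.\<close>

lemma bilinear_expand_Basis:
  fixes B :: "'a::euclidean_space \<Rightarrow> 'b::euclidean_space \<Rightarrow> real"
  assumes "bilinear B"
  shows "B u v = (\<Sum>k\<in>Basis. \<Sum>l\<in>Basis. (u \<bullet> k) * (v \<bullet> l) * B k l)"
proof -
  have "B u v = B (\<Sum>k\<in>Basis. (u \<bullet> k) *\<^sub>R k) (\<Sum>l\<in>Basis. (v \<bullet> l) *\<^sub>R l)"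
    by (simp add: euclidean_representation)
  also have "\<dots> = (\<Sum>(k,l)\<in>Basis\<times>Basis. B ((u \<bullet> k) *\<^sub>R k) ((v \<bullet> l) *\<^sub>R l))"
    by (rule bilinear_sum[OF assms])
  also have "\<dots> = (\<Sum>k\<in>Basis. \<Sum>l\<in>Basis. (u \<bullet> k) * (v \<bullet> l) * B k l)"
    by (simp add: sum.cartesian_product[symmetric] bilinear_lmul[OF assms] bilinear_rmul[OF assms] mult_ac)
  finally show ?thesis .
qed

lemma at_within_Int_nhd:
  assumes "open T" "t \<in> T"
  shows "at t within S \<inter> T = at t within S"
  by (rule at_within_nhd[of t T]) (use assms in auto)

lemma continuous_on_local:
  fixes S :: "'a::t2_space set"
  assumes "\<And>t. t \<in> S \<Longrightarrow> \<exists>W. open W \<and> t \<in> W \<and> continuous_on (S \<inter> W) f"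
  shows "continuous_on S f"
  unfolding continuous_on_eq_continuous_within
proof (intro ballI)
  fix t assume t: "t \<in> S"
  then obtain W where W: "open W" "t \<in> W" "continuous_on (S \<inter> W) f" using assms by blast
  then have "continuous (at t within S \<inter> W) f"
    using t by (auto simp: continuous_on_eq_continuous_within)
  moreover have "at t within S \<inter> W = at t within S"
    using W(1,2) by (rule at_within_Int_nhd)
  ultimately show "continuous (at t within S) f" by simp
qed

lemma continuous_within_open_nhd:
  assumes "continuous (at t within S) \<gamma>" "open W" "\<gamma> t \<in> W"
  obtains T where "open T" "t \<in> T" "\<And>s. s \<in> S \<inter> T \<Longrightarrow> \<gamma> s \<in> W"
proof -
  have "eventually (\<lambda>s. \<gamma> s \<in> W) (at t within S)"
    using assms unfolding continuous_within by (blast intro: topological_tendstoD)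
  then show ?thesis using that assms(3) unfolding eventually_at_topological by (metis IntE)
qed

lemma has_velocity_nhd:
  assumes M: "riemannian_manifold M" and v: "has_velocity M S \<gamma> v t"
    and c: "c \<in> charts M" "\<gamma> t \<in> cdom M c"
  obtains T where "open T" "t \<in> T" "\<And>s. s \<in> S \<inter> T \<Longrightarrow> \<gamma> s \<in> cdom M c"
  using continuous_within_open_nhd[OF has_velocityD(2)[OF v] manifold_chartD(1)[OF M c(1)] c(2)] by blast

lemma at_within_Icc_nontrivial:
  "a < b \<Longrightarrow> t \<in> {a..b} \<Longrightarrow> at t within {a..b} \<noteq> (bot :: real filter)"
  by (simp add: trivial_limit_within islimpt_Icc)

lemma C1_curve_velocity:
  assumes "C1_curve M a b \<gamma>" "t \<in> {a..b}"
  shows "has_velocity M {a..b} \<gamma> (velocity M {a..b} \<gamma> t) t"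
  using assms unfolding C1_curve_def by blast

lemma C1_curve_continuous:
  assumes "C1_curve M a b \<gamma>"
  shows "continuous_on {a..b} \<gamma>"
  using has_velocityD(2)[OF C1_curve_velocity[OF assms]]
  by (auto simp: continuous_on_eq_continuous_within)

text \<open>Near each time the curve stays in one chart, where the speed is an expression in the continuous
  coordinates of position and velocity.\<close>

lemma C1_curve_speed_continuous:
  assumes M: "riemannian_manifold M" and \<gamma>: "C1_curve M a b \<gamma>"
  shows "continuous_on {a..b} (\<lambda>t. riem_norm M (\<gamma> t) (velocity M {a..b} \<gamma> t))"
proof (rule continuous_on_local)
  fix t assume t: "t \<in> {a..b}"
  let ?v = "velocity M {a..b} \<gamma>"
  note v = C1_curve_velocity[OF \<gamma>]
  obtain c where c: "c \<in> charts M" "\<gamma> t \<in> cdom M c"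
    using obtain_chart[OF has_velocityD(1)[OF v[OF t]]] .
  obtain T where T: "open T" "t \<in> T" "\<And>s. s \<in> {a..b} \<inter> T \<Longrightarrow> \<gamma> s \<in> cdom M c"
    using has_velocity_nhd[OF M v[OF t] c] by blast
  let ?S = "{a..b} \<inter> T"
  have cv: "continuous_on ?S (\<lambda>s. ?v s c)"
    by (rule continuous_on_subset[of "{t\<in>{a..b}. \<gamma> t \<in> cdom M c}"])
      (use \<gamma> c T(3) in \<open>auto simp: C1_curve_def\<close>)
  have cg: "continuous_on ?S (\<lambda>s. cmap M c (\<gamma> s))"
    by (rule continuous_on_compose2[OF manifold_chartD(4)[OF M c(1)]])
      (use T(3) in \<open>auto intro: continuous_on_subset[OF C1_curve_continuous[OF \<gamma>]]\<close>)
  have ck: "continuous_on ?S (\<lambda>s. coeff M c (cmap M c (\<gamma> s)) k l)" for k l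
    by (rule continuous_on_compose2[OF coeff_continuous_on[OF M c(1)] cg]) (use T(3) in auto)
  have "continuous_on ?S (\<lambda>s. sqrt (\<Sum>k\<in>Basis. \<Sum>l\<in>Basis.
      (?v s c \<bullet> k) * (?v s c \<bullet> l) * coeff M c (cmap M c (\<gamma> s)) k l))"
    by (intro continuous_intros cv ck)
  moreover have "riem_norm M (\<gamma> s) (?v s) = sqrt (\<Sum>k\<in>Basis. \<Sum>l\<in>Basis.
      (?v s c \<bullet> k) * (?v s c \<bullet> l) * coeff M c (cmap M c (\<gamma> s)) k l)" if s: "s \<in> ?S" for s
  proof -
    have s': "s \<in> {a..b}" and d: "\<gamma> s \<in> cdom M c" using s T(3) by auto
    note tv = has_velocityD(3)[OF v[OF s']]
    have "riem_norm M (\<gamma> s) (?v s) = sqrt (coeff M c (cmap M c (\<gamma> s)) (?v s c) (?v s c))"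
      unfolding riem_norm_def riem_inner_chart[OF M c(1) d tv tv] ..
    then show ?thesis
      using bilinear_expand_Basis[OF coeff_bilinear[OF M c(1)]] d by simp
  qed
  ultimately have "continuous_on ?S (\<lambda>t. riem_norm M (\<gamma> t) (?v t))"
    by (elim continuous_on_eq) (rule sym)
  with T show "\<exists>W. open W \<and> t \<in> W \<and> continuous_on ({a..b} \<inter> W) (\<lambda>t. riem_norm M (\<gamma> t) (?v t))"
    by blast
qed

lemma velocity_at_within_cong:
  assumes "at t within S = at t within T"
  shows "has_velocity M S \<gamma> v t \<longleftrightarrow> has_velocity M T \<gamma> v t"
    and "velocity M S \<gamma> t = velocity M T \<gamma> t"
  using assms by (simp_all add: has_velocity_def velocity_def)

section \<open>Lengths of curves\<close>

text \<open>The integrand of the length. The velocity is taken relative to the whole interval even when the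
  curve is only piecewise regular, so the value at a break point carries no meaning.\<close>

definition speed ::
  "('i, 'a::topological_space, 'e::euclidean_space) riemannian \<Rightarrow> (real \<Rightarrow> 'a) \<Rightarrow> real \<Rightarrow> real" where
  "speed M \<gamma> t = riem_norm M (\<gamma> t) (velocity M {0..1} \<gamma> t)"

lemma curve_length_speed: "curve_length M \<gamma> = integral {0..1} (speed M \<gamma>)"
  unfolding curve_length_def speed_def ..

lemma subdivision_mono:
  fixes \<tau> :: "nat \<Rightarrow> real"
  assumes "\<And>j. j < k \<Longrightarrow> \<tau> j < \<tau> (Suc j)" "i \<le> j" "j \<le> k"
  shows "\<tau> i \<le> \<tau> j"
  using assms(2,3)
proof (induction j rule: dec_induct)
  case (step m)
  then show ?case using assms(1)[of m] by simp
qed simp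

lemma subdivision_piece:
  fixes \<tau> :: "nat \<Rightarrow> real"
  assumes "\<tau> 0 = 0" "\<tau> k = 1" "\<And>j. j < k \<Longrightarrow> \<tau> j < \<tau> (Suc j)" "t \<in> {0..1}" "t \<notin> \<tau> ` {..k}"
  obtains j where "j < k" "t \<in> {\<tau> j<..<\<tau> (Suc j)}"
proof -
  \<comment> \<open>the right end of the piece; it is not \<open>\<tau> 0\<close>, since \<open>t\<close> is positive\<close>
  define j where "j = (LEAST j. t \<le> \<tau> j)"
  have ex: "t \<le> \<tau> k" using assms by simp
  have 1: "t \<le> \<tau> j" "j \<le> k" using LeastI[of "\<lambda>j. t \<le> \<tau> j", OF ex] Least_le[of "\<lambda>j. t \<le> \<tau> j", OF ex]
    by (simp_all add: j_def)
  have "t \<noteq> \<tau> j" "t \<noteq> \<tau> 0" using assms(5) 1(2) by auto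
  then have "j \<noteq> 0" using 1 assms(1,4) by (cases "j = 0") auto
  then obtain i where i: "j = Suc i" using not0_implies_Suc by blast
  then have "\<not> t \<le> \<tau> i" using not_less_Least[of i "\<lambda>j. t \<le> \<tau> j"] by (simp add: j_def)
  then show ?thesis using that[of i] 1 i \<open>t \<noteq> \<tau> j\<close> by auto
qed

text \<open>Inside a piece of the subdivision the one-sided and the global notions of velocity coincide, so only
  the break points are exceptional.\<close>

lemma piecewise_C1_velocity:
  assumes "piecewise_C1_curve M \<gamma>"
  obtains B where "finite B"
    "\<And>t. t \<in> {0..1} - B \<Longrightarrow> has_velocity M {0..1} \<gamma> (velocity M {0..1} \<gamma> t) t"
proof -
  obtain k \<tau> where \<tau>: "\<tau> (0::nat) = (0::real)" "\<tau> k = 1"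
    "\<And>j. j < k \<Longrightarrow> \<tau> j < \<tau> (Suc j)" "\<And>j. j < k \<Longrightarrow> C1_curve M (\<tau> j) (\<tau> (Suc j)) \<gamma>"
    using assms unfolding piecewise_C1_curve_def by blast
  have "has_velocity M {0..1} \<gamma> (velocity M {0..1} \<gamma> t) t" if t: "t \<in> {0..1} - \<tau> ` {..k}" for t
  proof -
    obtain j where j: "j < k" "t \<in> {\<tau> j<..<\<tau> (Suc j)}"
      using subdivision_piece[OF \<tau>(1-3)] t by (metis DiffE)
    have "0 \<le> \<tau> j" "\<tau> (Suc j) \<le> 1"
      using subdivision_mono[of k \<tau> 0 j] subdivision_mono[of k \<tau> "Suc j" k] \<tau> j by auto
    \<comment> \<open>interior points: both filters are the two-sided one\<close>
    then have eq: "at t within {0..1} = at t within {\<tau> j..\<tau> (Suc j)}"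
      using j(2) by (simp add: at_within_Icc_at)
    show ?thesis
      unfolding velocity_at_within_cong[OF eq]
      using C1_curve_velocity[OF \<tau>(4)[OF j(1)], of t] j(2) by simp
  qed
  then show ?thesis by (rule that[of "\<tau> ` {..k}", rotated]) auto
qed

lemma piecewise_C1_in_points:
  assumes "piecewise_C1_curve M \<gamma>" "t \<in> {0..1}"
  shows "\<gamma> t \<in> points M"
proof -
  obtain k \<tau> where \<tau>: "\<tau> (0::nat) = (0::real)" "\<tau> k = 1"
    "\<And>j. j < k \<Longrightarrow> \<tau> j < \<tau> (Suc j)" "\<And>j. j < k \<Longrightarrow> C1_curve M (\<tau> j) (\<tau> (Suc j)) \<gamma>"
    using assms unfolding piecewise_C1_curve_def by blast
  have "\<exists>j<k. t \<in> {\<tau> j..\<tau> (Suc j)}"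
  proof (cases "t \<in> \<tau> ` {..k}")
    case True
    then obtain j where j: "j \<le> k" "t = \<tau> j" by auto
    have "k \<noteq> 0" using \<tau> by (metis zero_neq_one)
    show ?thesis
    proof (cases "j = k")
      case True
      then show ?thesis using j \<open>k \<noteq> 0\<close> \<tau>(3)[of "k - 1"] by (intro exI[of _ "k - 1"]) auto
    next
      case False
      then show ?thesis using j \<tau>(3)[of j] by (intro exI[of _ j]) auto
    qed
  next
    case False
    then show ?thesis using subdivision_piece[OF \<tau>(1-3) assms(2)]
      by (metis greaterThanLessThan_subseteq_atLeastAtMost_iff order_refl subsetD)
  qed
  then show ?thesis using has_velocityD(1)[OF C1_curve_velocity[OF \<tau>(4)]] by blast
qed

text \<open>On each closed piece the integrand differs from a continuous function at the two end points at
  most.\<close>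

lemma speed_integrable:
  assumes M: "riemannian_manifold M" and \<gamma>: "piecewise_C1_curve M \<gamma>"
  shows "speed M \<gamma> integrable_on {0..1}"
proof -
  obtain k \<tau> where \<tau>: "\<tau> (0::nat) = (0::real)" "\<tau> k = 1"
    "\<And>j. j < k \<Longrightarrow> \<tau> j < \<tau> (Suc j)" "\<And>j. j < k \<Longrightarrow> C1_curve M (\<tau> j) (\<tau> (Suc j)) \<gamma>"
    using \<gamma> unfolding piecewise_C1_curve_def by blast
  have piece: "speed M \<gamma> integrable_on {\<tau> j..\<tau> (Suc j)}" if j: "j < k" for j
  proof -
    have "0 \<le> \<tau> j" "\<tau> (Suc j) \<le> 1"
      using subdivision_mono[of k \<tau> 0 j] subdivision_mono[of k \<tau> "Suc j" k] \<tau> j by auto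
    then have eq: "speed M \<gamma> t = riem_norm M (\<gamma> t) (velocity M {\<tau> j..\<tau> (Suc j)} \<gamma> t)"
      if "t \<in> {\<tau> j..\<tau> (Suc j)} - {\<tau> j, \<tau> (Suc j)}" for t
      unfolding speed_def using that
      by (subst velocity_at_within_cong(2)[of t "{0..1}" "{\<tau> j..\<tau> (Suc j)}"])
        (auto simp: at_within_Icc_at)
    show ?thesis
      by (rule integrable_spike_finite[of "{\<tau> j, \<tau> (Suc j)}", OF _ eq
            integrable_continuous_real[OF C1_curve_speed_continuous[OF M \<tau>(4)[OF j]]]]) auto
  qed
  have "speed M \<gamma> integrable_on {0..\<tau> j}" if "j \<le> k" for j
    using that
  proof (induction j)
    case 0
    then show ?case using integrable_on_refl[of "speed M \<gamma>" 0] by (simp add: \<tau>(1))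
  next
    case (Suc j)
    have "0 \<le> \<tau> j" using subdivision_mono[of k \<tau> 0 j] \<tau> Suc.prems by auto
    then show ?case
      using Henstock_Kurzweil_Integration.integrable_combine[of 0 "\<tau> j" "\<tau> (Suc j)"]
        Suc piece[of j] \<tau>(3)[of j] by simp
  qed
  from this[of k] show ?thesis using \<tau>(2) by simp
qed

lemma speed_nonneg:
  assumes "riemannian_manifold M" "piecewise_C1_curve M \<gamma>" "t \<in> {0..1}"
  shows "speed M \<gamma> t \<ge> 0"
  unfolding speed_def using riem_norm_nonneg[OF assms(1)] piecewise_C1_in_points[OF assms(2,3)] .

lemma curve_length_nonneg:
  assumes "riemannian_manifold M" "piecewise_C1_curve M \<gamma>"
  shows "curve_length M \<gamma> \<ge> 0"
  unfolding curve_length_speed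
  using speed_integrable[OF assms] speed_nonneg[OF assms] by (rule integral_nonneg)

text \<open>Nonnegativity of lengths is what makes the infimum in the distance a lower bound.\<close>

lemma riem_dist_le_length:
  assumes "riemannian_manifold M" "piecewise_C1_curve M \<gamma>" "\<gamma> 0 = p" "\<gamma> 1 = q"
  shows "riem_dist M p q \<le> curve_length M \<gamma>"
  unfolding riem_dist_def
  by (rule cInf_lower) (use assms curve_length_nonneg in \<open>auto intro!: bdd_belowI[of _ 0]\<close>)

section \<open>Lengths of curves in a product\<close>

text \<open>Continuity of the velocity of a component in a chart of its factor is local in time, and near each
  time the other component stays in one chart too, so that a chart of the product is available.\<close>

lemma C1_curve_prod:
  assumes M: "riemannian_manifold M" and N: "riemannian_manifold N" and ab: "a < b"
    and \<gamma>: "C1_curve (riem_prod M N) a b \<gamma>"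
  shows "C1_curve M a b (fst \<circ> \<gamma>)" and "C1_curve N a b (snd \<circ> \<gamma>)"
proof -
  let ?v = "velocity M {a..b} (fst \<circ> \<gamma>)" and ?w = "velocity N {a..b} (snd \<circ> \<gamma>)"
    and ?V = "velocity (riem_prod M N) {a..b} \<gamma>"
  note vel = velocity_prod[OF M N C1_curve_velocity[OF \<gamma>] at_within_Icc_nontrivial[OF ab]]
  have cont: "continuous_on {t \<in> {a..b}. fst (\<gamma> t) \<in> cdom M c \<and> snd (\<gamma> t) \<in> cdom N d} (\<lambda>t. (?v t c, ?w t d))"
    if cd: "c \<in> charts M" "d \<in> charts N" for c d
  proof (rule continuous_on_eq)
    have "continuous_on {t \<in> {a..b}. \<gamma> t \<in> cdom (riem_prod M N) (c, d)} (\<lambda>t. ?V t (c, d))"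
      using \<gamma> cd unfolding C1_curve_def by auto
    then show "continuous_on {t \<in> {a..b}. fst (\<gamma> t) \<in> cdom M c \<and> snd (\<gamma> t) \<in> cdom N d} (\<lambda>t. ?V t (c, d))"
      by (simp add: mem_Times_iff)
    show "?V t (c, d) = (?v t c, ?w t d)"
      if "t \<in> {t \<in> {a..b}. fst (\<gamma> t) \<in> cdom M c \<and> snd (\<gamma> t) \<in> cdom N d}" for t
      using vel(3)[of t] that cd by simp
  qed
  show "C1_curve M a b (fst \<circ> \<gamma>)" unfolding C1_curve_def
  proof (intro conjI ballI)
    show "has_velocity M {a..b} (fst \<circ> \<gamma>) (?v t) t" if "t \<in> {a..b}" for t
      using vel(1) that by blast
    fix c assume c: "c \<in> charts M"
    show "continuous_on {t \<in> {a..b}. (fst \<circ> \<gamma>) t \<in> cdom M c} (\<lambda>t. ?v t c)" (is "continuous_on ?S _")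
    proof (rule continuous_on_local)
      fix t assume t: "t \<in> ?S"
      then obtain d where d: "d \<in> charts N" "(snd \<circ> \<gamma>) t \<in> cdom N d"
        using obtain_chart[OF has_velocityD(1)[OF vel(2)]] by blast
      obtain T where T: "open T" "t \<in> T" "\<And>s. s \<in> {a..b} \<inter> T \<Longrightarrow> (snd \<circ> \<gamma>) s \<in> cdom N d"
        using has_velocity_nhd[OF N vel(2) d] t by blast
      have "continuous_on (?S \<inter> T) (\<lambda>t. fst (?v t c, ?w t d))"
        by (rule continuous_on_fst, rule continuous_on_subset[OF cont[OF c d(1)]]) (use T(3) in auto)
      then show "\<exists>W. open W \<and> t \<in> W \<and> continuous_on (?S \<inter> W) (\<lambda>t. ?v t c)"
        using T by auto
    qed
  qed
  show "C1_curve N a b (snd \<circ> \<gamma>)" unfolding C1_curve_def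
  proof (intro conjI ballI)
    show "has_velocity N {a..b} (snd \<circ> \<gamma>) (?w t) t" if "t \<in> {a..b}" for t
      using vel(2) that by blast
    fix d assume d: "d \<in> charts N"
    show "continuous_on {t \<in> {a..b}. (snd \<circ> \<gamma>) t \<in> cdom N d} (\<lambda>t. ?w t d)" (is "continuous_on ?S _")
    proof (rule continuous_on_local)
      fix t assume t: "t \<in> ?S"
      then obtain c where c: "c \<in> charts M" "(fst \<circ> \<gamma>) t \<in> cdom M c"
        using obtain_chart[OF has_velocityD(1)[OF vel(1)]] by blast
      obtain T where T: "open T" "t \<in> T" "\<And>s. s \<in> {a..b} \<inter> T \<Longrightarrow> (fst \<circ> \<gamma>) s \<in> cdom M c"
        using has_velocity_nhd[OF M vel(1) c] t by blast
      have "continuous_on (?S \<inter> T) (\<lambda>t. snd (?v t c, ?w t d))"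
        by (rule continuous_on_snd, rule continuous_on_subset[OF cont[OF c(1) d]]) (use T(3) in auto)
      then show "\<exists>W. open W \<and> t \<in> W \<and> continuous_on (?S \<inter> W) (\<lambda>t. ?w t d)"
        using T by auto
    qed
  qed
qed

lemma piecewise_C1_curve_prod:
  assumes M: "riemannian_manifold M" and N: "riemannian_manifold N"
    and \<gamma>: "piecewise_C1_curve (riem_prod M N) \<gamma>"
  shows "piecewise_C1_curve M (fst \<circ> \<gamma>)" and "piecewise_C1_curve N (snd \<circ> \<gamma>)"
  using \<gamma> C1_curve_prod[OF M N] unfolding piecewise_C1_curve_def by meson+

lemma speed_prod:
  assumes M: "riemannian_manifold M" and N: "riemannian_manifold N"
    and V: "has_velocity (riem_prod M N) {0..1} \<gamma> V t" and t: "t \<in> {0..1}"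
  shows "speed (riem_prod M N) \<gamma> t =
    sqrt ((speed M (fst \<circ> \<gamma>) t)\<^sup>2 + (speed N (snd \<circ> \<gamma>) t)\<^sup>2)"
proof -
  have "at t within {0..1} \<noteq> bot" using t by (intro at_within_Icc_nontrivial) auto
  note vel = velocity_prod[OF M N V this]
  show ?thesis
    using riem_norm_prod[OF M has_velocityD(1,3)[OF vel(1)] N has_velocityD(1,3)[OF vel(2)]]
    by (simp add: speed_def vel(3))
qed

text \<open>This is the triangle inequality for the vector-valued integral of \<open>(f, g)\<close>, where \<open>f\<close>, \<open>g\<close> are the
  speeds of the components: if \<open>(a, b)\<close> is the value of the integral, pair the integrand with
  \<open>(a, b)\<close> and apply Cauchy-Schwarz pointwise.\<close>

lemma curve_length_prod_ge:
  assumes M: "riemannian_manifold M" and N: "riemannian_manifold N"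
    and \<gamma>: "piecewise_C1_curve (riem_prod M N) \<gamma>"
  shows "sqrt ((curve_length M (fst \<circ> \<gamma>))\<^sup>2 + (curve_length N (snd \<circ> \<gamma>))\<^sup>2)
    \<le> curve_length (riem_prod M N) \<gamma>"
proof -
  note \<gamma>12 = piecewise_C1_curve_prod[OF M N \<gamma>]
  define f g where "f = speed M (fst \<circ> \<gamma>)" and "g = speed N (snd \<circ> \<gamma>)"
  define P where "P = (\<lambda>t. sqrt ((f t)\<^sup>2 + (g t)\<^sup>2))"
  have fi: "f integrable_on {0..1}" and gi: "g integrable_on {0..1}"
    using speed_integrable M N \<gamma>12 by (auto simp: f_def g_def)
  have f0: "f t \<ge> 0" and g0: "g t \<ge> 0" if "t \<in> {0..1}" for t
    using speed_nonneg M N \<gamma>12 that by (auto simp: f_def g_def)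
  obtain B where B: "finite B"
    "\<And>t. t \<in> {0..1} - B \<Longrightarrow>
      has_velocity (riem_prod M N) {0..1} \<gamma> (velocity (riem_prod M N) {0..1} \<gamma> t) t"
    using piecewise_C1_velocity[OF \<gamma>] by blast
  have L: "curve_length (riem_prod M N) \<gamma> = integral {0..1} P"
    unfolding curve_length_speed
  proof (rule integral_spike[OF negligible_finite[OF B(1)]])
    show "P t = speed (riem_prod M N) \<gamma> t" if "t \<in> {0..1} - B" for t
      using speed_prod[OF M N B(2)[OF that]] that by (simp add: P_def f_def g_def)
  qed
  \<comment> \<open>\<open>P\<close> is measurable and dominated by the integrable function \<open>f + g\<close>, so no second look at the
    subdivision is needed\<close>
  have Pi: "P integrable_on {0..1}"
  proof (rule measurable_bounded_by_integrable_imp_integrable[of _ _ "\<lambda>t. f t + g t"])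
    show "P \<in> borel_measurable (lebesgue_on {0..1})"
      unfolding P_def using integrable_imp_measurable[OF fi] integrable_imp_measurable[OF gi]
      by measurable
    show "(\<lambda>t. f t + g t) integrable_on {0..1}" using fi gi by (rule integrable_add)
    show "norm (P t) \<le> f t + g t" if "t \<in> {0..1}" for t
      using sqrt_sum_squares_le_sum[OF f0[OF that] g0[OF that]] by (simp add: P_def)
  qed simp
  define a b r where "a = integral {0..1} f" and "b = integral {0..1} g" and "r = sqrt (a\<^sup>2 + b\<^sup>2)"
  have "a * integral {0..1} f + b * integral {0..1} g = integral {0..1} (\<lambda>t. a * f t + b * g t)"
    using fi gi by (subst integral_add) (auto intro: integrable_on_mult_right)
  also have "\<dots> \<le> integral {0..1} (\<lambda>t. r * P t)"
  proof (rule integral_le)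
    show "(\<lambda>t. a * f t + b * g t) integrable_on {0..1}" "(\<lambda>t. r * P t) integrable_on {0..1}"
      using fi gi Pi by (auto intro!: integrable_add integrable_on_mult_right)
    show "a * f t + b * g t \<le> r * P t" if "t \<in> {0..1}" for t
      using norm_cauchy_schwarz[of "(a, b)" "(f t, g t)"] by (simp add: norm_prod_def r_def P_def)
  qed
  also have "\<dots> = r * integral {0..1} P" by simp
  finally have "r * r \<le> r * integral {0..1} P"
    by (simp add: a_def[symmetric] b_def[symmetric] r_def flip: power2_eq_square)
  moreover have "0 \<le> integral {0..1} P" using Pi by (rule integral_nonneg) (simp add: P_def)
  moreover have "0 \<le> r" by (simp add: r_def)
  ultimately have "r \<le> integral {0..1} P"
    by (cases "r = 0") (auto simp: mult_le_cancel_left_pos)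
  then show ?thesis unfolding L by (simp add: r_def a_def b_def f_def g_def curve_length_speed)
qed

section \<open>Geodesics have constant speed\<close>

lemma has_vector_derivative_transform_nhd:
  assumes "(f has_vector_derivative f') (at t within S)" "open T" "t \<in> T" "t \<in> S"
    and "\<And>s. s \<in> S \<inter> T \<Longrightarrow> g s = f s"
  shows "(g has_vector_derivative f') (at t within S)"
proof -
  have "(g has_vector_derivative f') (at t within S \<inter> T)"
    by (rule has_vector_derivative_transform[of t "S \<inter> T" g f])
      (use assms at_within_Int_nhd[OF assms(2,3), of S] in auto)
  then show ?thesis unfolding at_within_Int_nhd[OF assms(2,3)] .
qed

lemma geodesic_velocity:
  assumes "geodesic M \<gamma>" "t \<in> {0..1}"
  shows "has_velocity M {0..1} \<gamma> (velocity M {0..1} \<gamma> t) t"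
  using assms unfolding geodesic_def by blast

lemma geodesic_acceleration:
  assumes "geodesic M \<gamma>" "t \<in> {0..1}" "c \<in> charts M" "\<gamma> t \<in> cdom M c"
  obtains A where "((\<lambda>s. velocity M {0..1} \<gamma> s c) has_vector_derivative A) (at t within {0..1})"
    "\<And>w. coeff M c (cmap M c (\<gamma> t)) A w + christoffel M c (cmap M c (\<gamma> t))
                    (velocity M {0..1} \<gamma> t c) (velocity M {0..1} \<gamma> t c) w = 0"
  using assms unfolding geodesic_def by blast

text \<open>The acceleration exists in every chart, so the velocity is continuous.\<close>

lemma geodesic_C1_curve:
  assumes "geodesic M \<gamma>"
  shows "C1_curve M 0 1 \<gamma>"
  unfolding C1_curve_def
proof (intro conjI ballI)
  show "has_velocity M {0..1} \<gamma> (velocity M {0..1} \<gamma> t) t" if "t \<in> {0..1}" for t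
    using assms that by (rule geodesic_velocity)
  fix c assume c: "c \<in> charts M"
  show "continuous_on {t \<in> {0..1}. \<gamma> t \<in> cdom M c} (\<lambda>t. velocity M {0..1} \<gamma> t c)"
    unfolding continuous_on_eq_continuous_within
  proof (intro ballI)
    fix t assume t: "t \<in> {t \<in> {0..1}. \<gamma> t \<in> cdom M c}"
    then obtain A where "((\<lambda>s. velocity M {0..1} \<gamma> s c) has_vector_derivative A) (at t within {0..1})"
      using geodesic_acceleration[OF assms _ c] by blast
    then have "continuous (at t within {0..1}) (\<lambda>t. velocity M {0..1} \<gamma> t c)"
      by (rule has_vector_derivative_continuous)
    then show "continuous (at t within {t \<in> {0..1}. \<gamma> t \<in> cdom M c}) (\<lambda>t. velocity M {0..1} \<gamma> t c)"
      by (rule continuous_within_subset) auto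
  qed
qed

lemma geodesic_piecewise_C1:
  assumes "geodesic M \<gamma>"
  shows "piecewise_C1_curve M \<gamma>"
  unfolding piecewise_C1_curve_def
  by (intro exI[of _ "1::nat"] exI[of _ real]) (use geodesic_C1_curve[OF assms] in simp)

lemma frechet_derivative_coeff:
  assumes M: "riemannian_manifold M" and c: "c \<in> charts M" and q: "q \<in> cmap M c ` cdom M c"
  shows "frechet_derivative (\<lambda>q. coeff M c q u v) (at q) h =
    (\<Sum>k\<in>Basis. \<Sum>l\<in>Basis. (u \<bullet> k) * (v \<bullet> l) * frechet_derivative (\<lambda>q. coeff M c q k l) (at q) h)"
proof -
  have d: "((\<lambda>q. coeff M c q k l) has_derivative frechet_derivative (\<lambda>q. coeff M c q k l) (at q)) (at q)"
    for k l
    using coeff_differentiable[OF M c q] by (simp add: frechet_derivative_works)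
  have "((\<lambda>q. \<Sum>k\<in>Basis. \<Sum>l\<in>Basis. (u \<bullet> k) * (v \<bullet> l) * coeff M c q k l) has_derivative
     (\<lambda>h. \<Sum>k\<in>Basis. \<Sum>l\<in>Basis. (u \<bullet> k) * (v \<bullet> l) * frechet_derivative (\<lambda>q. coeff M c q k l) (at q) h)) (at q)"
    by (intro has_derivative_sum has_derivative_mult_right d)
  then have "((\<lambda>q. coeff M c q u v) has_derivative
     (\<lambda>h. \<Sum>k\<in>Basis. \<Sum>l\<in>Basis. (u \<bullet> k) * (v \<bullet> l) * frechet_derivative (\<lambda>q. coeff M c q k l) (at q) h)) (at q)"
    by (rule has_derivative_transform_within_open[OF _ manifold_chartD(2)[OF M c] q])
      (rule bilinear_expand_Basis[OF coeff_bilinear[OF M c], symmetric])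
  from frechet_derivative_at[OF this, symmetric] show ?thesis by simp
qed

text \<open>In a chart, with velocity \<open>u\<close> and acceleration \<open>A\<close>, the derivative of \<open>g(u,u)\<close> along the curve is
  \<open>2 g(A,u) + \<partial>\<^sub>u g(u,u)\<close>. The geodesic equation paired with \<open>u\<close> says that this vanishes, because
  the three terms of the Christoffel symbol all become \<open>\<partial>\<^sub>u g(u,u)\<close> up to sign.\<close>

lemma geodesic_constant_speed:
  assumes M: "riemannian_manifold M" and \<gamma>: "geodesic M \<gamma>" and t: "t \<in> {0..1}"
  shows "speed M \<gamma> t = curve_length M \<gamma>"
proof -
  let ?v = "velocity M {0..1} \<gamma>"
  let ?\<phi> = "\<lambda>t. riem_inner M (\<gamma> t) (?v t) (?v t)"
  have "(?\<phi> has_vector_derivative 0) (at t within {0..1})" if t: "t \<in> {0..1}" for t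
  proof -
    note v = geodesic_velocity[OF \<gamma>]
    obtain c where c: "c \<in> charts M" "\<gamma> t \<in> cdom M c"
      using obtain_chart[OF has_velocityD(1)[OF v[OF t]]] .
    obtain T where T: "open T" "t \<in> T" "\<And>s. s \<in> {0..1} \<inter> T \<Longrightarrow> \<gamma> s \<in> cdom M c"
      using has_velocity_nhd[OF M v[OF t] c] by blast
    obtain A where A: "((\<lambda>s. ?v s c) has_vector_derivative A) (at t within {0..1})"
      "coeff M c (cmap M c (\<gamma> t)) A (?v t c) + christoffel M c (cmap M c (\<gamma> t)) (?v t c) (?v t c) (?v t c) = 0"
      using geodesic_acceleration[OF \<gamma> t c] by blast
    define x u C D where "x = cmap M c (\<gamma> t)" and "u = ?v t c" and "C = coeff M c x"
      and "D = (\<lambda>k l. frechet_derivative (\<lambda>q. coeff M c q k l) (at x))"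
    have xi: "x \<in> cmap M c ` cdom M c" using c by (simp add: x_def)
    have dC: "((\<lambda>s. coeff M c (cmap M c (\<gamma> s)) k l) has_real_derivative D k l u) (at t within {0..1})" for k l
    proof -
      have "((\<lambda>q. coeff M c q k l) has_derivative D k l) (at ((cmap M c \<circ> \<gamma>) t) within (cmap M c \<circ> \<gamma>) ` {0..1})"
        using coeff_differentiable[OF M c(1) xi, of k l]
        unfolding frechet_derivative_works D_def x_def o_def by (rule has_derivative_at_withinI)
      from vector_derivative_diff_chain_within[OF has_velocityD(4)[OF v[OF t] c] this]
      show ?thesis by (simp add: o_def u_def has_real_derivative_iff_has_vector_derivative)
    qed
    have dv: "((\<lambda>s. ?v s c \<bullet> k) has_real_derivative A \<bullet> k) (at t within {0..1})" for k
      using bounded_linear.has_vector_derivative[OF bounded_linear_inner_left A(1)]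
      by (simp add: has_real_derivative_iff_has_vector_derivative)
    have "((\<lambda>s. \<Sum>k\<in>Basis. \<Sum>l\<in>Basis. (?v s c \<bullet> k) * (?v s c \<bullet> l) * coeff M c (cmap M c (\<gamma> s)) k l)
        has_real_derivative (\<Sum>k\<in>Basis. \<Sum>l\<in>Basis.
          (u \<bullet> k) * (u \<bullet> l) * D k l u + ((u \<bullet> k) * (A \<bullet> l) + (A \<bullet> k) * (u \<bullet> l)) * C k l))
        (at t within {0..1})"
      unfolding u_def C_def x_def
      by (intro DERIV_sum DERIV_mult' dv dC[unfolded u_def])
    moreover have "(\<Sum>k\<in>Basis. \<Sum>l\<in>Basis.
          (u \<bullet> k) * (u \<bullet> l) * D k l u + ((u \<bullet> k) * (A \<bullet> l) + (A \<bullet> k) * (u \<bullet> l)) * C k l) =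
        C u A + C A u + D u u u"
    proof -
      note B = bilinear_expand_Basis[OF coeff_bilinear[OF M c(1) xi], folded C_def]
      have "D u u u = (\<Sum>k\<in>Basis. \<Sum>l\<in>Basis. (u \<bullet> k) * (u \<bullet> l) * D k l u)"
        unfolding D_def by (rule frechet_derivative_coeff[OF M c(1) xi])
      then show ?thesis
        unfolding B[of u A] B[of A u] by (simp add: sum.distrib[symmetric] algebra_simps)
    qed
    moreover have "C u A + C A u + D u u u = 0"
      using A(2) coeff_sym[OF M c(1) xi, of u A]
      by (simp add: christoffel_def x_def[symmetric] u_def[symmetric] C_def D_def)
    ultimately have "((\<lambda>s. \<Sum>k\<in>Basis. \<Sum>l\<in>Basis. (?v s c \<bullet> k) * (?v s c \<bullet> l) * coeff M c (cmap M c (\<gamma> s)) k l)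
        has_vector_derivative 0) (at t within {0..1})"
      by (simp add: has_real_derivative_iff_has_vector_derivative)
    then show ?thesis
    proof (rule has_vector_derivative_transform_nhd[OF _ T(1,2) t])
      fix s assume s: "s \<in> {0..1} \<inter> T"
      then have s': "s \<in> {0..1}" and d: "\<gamma> s \<in> cdom M c" using T(3) by auto
      note tv = has_velocityD(3)[OF v[OF s']]
      show "?\<phi> s = (\<Sum>k\<in>Basis. \<Sum>l\<in>Basis. (?v s c \<bullet> k) * (?v s c \<bullet> l) * coeff M c (cmap M c (\<gamma> s)) k l)"
        unfolding riem_inner_chart[OF M c(1) d tv tv]
        using bilinear_expand_Basis[OF coeff_bilinear[OF M c(1)]] d by simp
    qed
  qed
  then have "\<exists>k. \<forall>t\<in>{0..1}. ?\<phi> t = k"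
    by (intro has_derivative_zero_constant) (auto simp: has_vector_derivative_def)
  then obtain k where k: "\<And>t. t \<in> {0..1} \<Longrightarrow> speed M \<gamma> t = sqrt k"
    by (auto simp: speed_def riem_norm_def)
  then have "curve_length M \<gamma> = integral {0..1} (\<lambda>t::real. sqrt k)"
    unfolding curve_length_speed by (intro integral_cong) auto
  then show ?thesis using k[OF t] by simp
qed

section \<open>Geodesics of a product\<close>

lemma frechet_derivative_coeff_prod:
  assumes M: "riemannian_manifold M" "c \<in> charts M" "q \<in> cmap M c ` cdom M c"
    and N: "riemannian_manifold N" "d \<in> charts N" "r \<in> cmap N d ` cdom N d"
  shows "frechet_derivative (\<lambda>q. coeff (riem_prod M N) (c, d) q u v) (at (q, r)) h =
    frechet_derivative (\<lambda>q. coeff M c q (fst u) (fst v)) (at q) (fst h) +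
    frechet_derivative (\<lambda>q. coeff N d q (snd u) (snd v)) (at r) (snd h)"
proof -
  have 1: "((\<lambda>q. coeff M c q (fst u) (fst v)) has_derivative
      frechet_derivative (\<lambda>q. coeff M c q (fst u) (fst v)) (at q)) (at (fst (q, r)))"
    using coeff_differentiable[OF M] by (simp add: frechet_derivative_works)
  have 2: "((\<lambda>q. coeff N d q (snd u) (snd v)) has_derivative
      frechet_derivative (\<lambda>q. coeff N d q (snd u) (snd v)) (at r)) (at (snd (q, r)))"
    using coeff_differentiable[OF N] by (simp add: frechet_derivative_works)
  have "((\<lambda>q. coeff (riem_prod M N) (c, d) q u v) has_derivative
    (\<lambda>h. frechet_derivative (\<lambda>q. coeff M c q (fst u) (fst v)) (at q) (fst h) +
      frechet_derivative (\<lambda>q. coeff N d q (snd u) (snd v)) (at r) (snd h))) (at (q, r))"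
    unfolding riem_prod_simps
    by (intro has_derivative_add
        has_derivative_compose[OF has_derivative_fst[OF has_derivative_ident] 1]
        has_derivative_compose[OF has_derivative_snd[OF has_derivative_ident] 2])
  from frechet_derivative_at[OF this, symmetric] show ?thesis by simp
qed

text \<open>Each coefficient of the product metric is a function of one factor plus a function of the other,
  so there are no mixed derivatives.\<close>

lemma christoffel_prod:
  assumes "riemannian_manifold M" "c \<in> charts M" "q \<in> cmap M c ` cdom M c"
    and "riemannian_manifold N" "d \<in> charts N" "r \<in> cmap N d ` cdom N d"
  shows "christoffel (riem_prod M N) (c, d) (q, r) u v w =
    christoffel M c q (fst u) (fst v) (fst w) + christoffel N d r (snd u) (snd v) (snd w)"
  unfolding christoffel_def frechet_derivative_coeff_prod[OF assms] by (simp add: field_simps)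

lemma christoffel_zero:
  assumes M: "riemannian_manifold M" and c: "c \<in> charts M" and q: "q \<in> cmap M c ` cdom M c"
  shows "christoffel M c q u v 0 = 0"
proof -
  have "linear (frechet_derivative (\<lambda>q. coeff M c q u v) (at q))"
    using linear_frechet_derivative[OF coeff_differentiable[OF M c q]] .
  then show ?thesis
    unfolding christoffel_def using frechet_derivative_coeff[OF M c q, of _ 0]
    by (simp add: linear_0)
qed

text \<open>The geodesic equation of the product is the sum of the equations of the two factors.\<close>

lemma geodesic_Pair:
  assumes M: "riemannian_manifold M" and N: "riemannian_manifold N"
    and \<alpha>: "geodesic M \<alpha>" and \<beta>: "geodesic N \<beta>"
  shows "geodesic (riem_prod M N) (\<lambda>t. (\<alpha> t, \<beta> t))"
  unfolding geodesic_def
proof (intro ballI conjI impI)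
  let ?v = "velocity M {0..1} \<alpha>" and ?w = "velocity N {0..1} \<beta>"
    and ?V = "velocity (riem_prod M N) {0..1} (\<lambda>t. (\<alpha> t, \<beta> t))"
  note v = geodesic_velocity[OF \<alpha>] and w = geodesic_velocity[OF \<beta>]
  have vw: "has_velocity (riem_prod M N) {0..1} (\<lambda>t. (\<alpha> t, \<beta> t))
      (prod_tangent M N (\<alpha> t) (\<beta> t) (?v t) (?w t)) t" if "t \<in> {0..1}" for t
    using has_velocity_Pair[OF M N v[OF that] w[OF that]] .
  then have V: "?V t = prod_tangent M N (\<alpha> t) (\<beta> t) (?v t) (?w t)" if "t \<in> {0..1}" for t
    using that at_within_Icc_nontrivial[of 0 1 t] by (intro velocity_eqI) auto
  fix t :: real assume t: "t \<in> {0..1}"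
  show "has_velocity (riem_prod M N) {0..1} (\<lambda>t. (\<alpha> t, \<beta> t)) (?V t) t"
    unfolding V[OF t] using t by (rule vw)
  fix e assume e: "e \<in> charts (riem_prod M N)" "(\<alpha> t, \<beta> t) \<in> cdom (riem_prod M N) e"
  obtain c d where cd: "e = (c, d)" by (cases e)
  then have c: "c \<in> charts M" "\<alpha> t \<in> cdom M c" and d: "d \<in> charts N" "\<beta> t \<in> cdom N d"
    using e by auto
  obtain T where T: "open T" "t \<in> T" "\<And>s. s \<in> {0..1} \<inter> T \<Longrightarrow> \<alpha> s \<in> cdom M c"
    using has_velocity_nhd[OF M v[OF t] c] by blast
  obtain T' where T': "open T'" "t \<in> T'" "\<And>s. s \<in> {0..1} \<inter> T' \<Longrightarrow> \<beta> s \<in> cdom N d"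
    using has_velocity_nhd[OF N w[OF t] d] by blast
  obtain A where A: "((\<lambda>s. ?v s c) has_vector_derivative A) (at t within {0..1})"
    "\<And>u. coeff M c (cmap M c (\<alpha> t)) A u + christoffel M c (cmap M c (\<alpha> t)) (?v t c) (?v t c) u = 0"
    using geodesic_acceleration[OF \<alpha> t c] by blast
  obtain B where B: "((\<lambda>s. ?w s d) has_vector_derivative B) (at t within {0..1})"
    "\<And>u. coeff N d (cmap N d (\<beta> t)) B u + christoffel N d (cmap N d (\<beta> t)) (?w t d) (?w t d) u = 0"
    using geodesic_acceleration[OF \<beta> t d] by blast
  have Vt: "?V t e = (?v t c, ?w t d)" using V[OF t] c d by (simp add: cd)
  show "\<exists>A. ((\<lambda>s. ?V s e) has_vector_derivative A) (at t within {0..1}) \<and>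
      (\<forall>u. coeff (riem_prod M N) e (cmap (riem_prod M N) e (\<alpha> t, \<beta> t)) A u +
        christoffel (riem_prod M N) e (cmap (riem_prod M N) e (\<alpha> t, \<beta> t)) (?V t e) (?V t e) u = 0)"
  proof (intro exI[of _ "(A, B)"] conjI allI)
    show "((\<lambda>s. ?V s e) has_vector_derivative (A, B)) (at t within {0..1})"
      by (rule has_vector_derivative_transform_nhd[OF has_vector_derivative_Pair[OF A(1) B(1)], of "T \<inter> T'"])
        (use T T' t c d in \<open>auto simp: V cd\<close>)
    fix u
    have "christoffel (riem_prod M N) e (cmap (riem_prod M N) e (\<alpha> t, \<beta> t)) (?V t e) (?V t e) u =
        christoffel M c (cmap M c (\<alpha> t)) (?v t c) (?v t c) (fst u) +
        christoffel N d (cmap N d (\<beta> t)) (?w t d) (?w t d) (snd u)"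
      unfolding Vt using christoffel_prod[OF M c(1) _ N d(1)] c d by (simp add: cd)
    then show "coeff (riem_prod M N) e (cmap (riem_prod M N) e (\<alpha> t, \<beta> t)) (A, B) u +
        christoffel (riem_prod M N) e (cmap (riem_prod M N) e (\<alpha> t, \<beta> t)) (?V t e) (?V t e) u = 0"
      using A(2)[of "fst u"] B(2)[of "snd u"] by (simp add: cd)
  qed
qed

text \<open>Conversely, the equation of one factor is recovered by pairing the equation of the product with
  vectors \<open>(u, 0)\<close> or \<open>(0, u)\<close>. Both equations are obtained together, in a pair of charts around the two
  components.\<close>

lemma geodesic_prodD:
  assumes M: "riemannian_manifold M" and N: "riemannian_manifold N"
    and \<gamma>: "geodesic (riem_prod M N) \<gamma>"
  shows "geodesic M (fst \<circ> \<gamma>)" and "geodesic N (snd \<circ> \<gamma>)"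
proof -
  let ?v = "velocity M {0..1} (fst \<circ> \<gamma>)" and ?w = "velocity N {0..1} (snd \<circ> \<gamma>)"
    and ?V = "velocity (riem_prod M N) {0..1} \<gamma>"
  note V = geodesic_velocity[OF \<gamma>]
  have vw: "has_velocity M {0..1} (fst \<circ> \<gamma>) (?v t) t" "has_velocity N {0..1} (snd \<circ> \<gamma>) (?w t) t"
    "?V t = prod_tangent M N (fst (\<gamma> t)) (snd (\<gamma> t)) (?v t) (?w t)" if "t \<in> {0..1}" for t
    using velocity_prod[OF M N V at_within_Icc_nontrivial] that by auto
  have eq: "\<exists>A B. ((\<lambda>s. ?v s c) has_vector_derivative A) (at t within {0..1}) \<and>
      ((\<lambda>s. ?w s d) has_vector_derivative B) (at t within {0..1}) \<and>
      (\<forall>u. coeff M c (cmap M c ((fst \<circ> \<gamma>) t)) A u +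
        christoffel M c (cmap M c ((fst \<circ> \<gamma>) t)) (?v t c) (?v t c) u = 0) \<and>
      (\<forall>u. coeff N d (cmap N d ((snd \<circ> \<gamma>) t)) B u +
        christoffel N d (cmap N d ((snd \<circ> \<gamma>) t)) (?w t d) (?w t d) u = 0)"
    if t: "t \<in> {0..1}" and c: "c \<in> charts M" "(fst \<circ> \<gamma>) t \<in> cdom M c"
      and d: "d \<in> charts N" "(snd \<circ> \<gamma>) t \<in> cdom N d" for t c d
  proof -
    have cd: "(c, d) \<in> charts (riem_prod M N)" "\<gamma> t \<in> cdom (riem_prod M N) (c, d)"
      using c d by (auto simp: mem_Times_iff)
    define q r where "q = cmap M c ((fst \<circ> \<gamma>) t)" and "r = cmap N d ((snd \<circ> \<gamma>) t)"
    have qi: "q \<in> cmap M c ` cdom M c" and ri: "r \<in> cmap N d ` cdom N d"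
      using c d by (auto simp: q_def r_def)
    have qr: "cmap (riem_prod M N) (c, d) (\<gamma> t) = (q, r)"
      by (cases "\<gamma> t") (simp add: q_def r_def)
    obtain T where T: "open T" "t \<in> T" "\<And>s. s \<in> {0..1} \<inter> T \<Longrightarrow> \<gamma> s \<in> cdom (riem_prod M N) (c, d)"
    proof -
      have "open (cdom (riem_prod M N) (c, d))"
        using manifold_chartD(1)[OF M c(1)] manifold_chartD(1)[OF N d(1)] by (simp add: open_Times)
      from continuous_within_open_nhd[OF has_velocityD(2)[OF V[OF t]] this cd(2)] that
      show ?thesis by blast
    qed
    obtain E where E: "((\<lambda>s. ?V s (c, d)) has_vector_derivative E) (at t within {0..1})"
      "\<And>u. coeff (riem_prod M N) (c, d) (q, r) E u +
        christoffel (riem_prod M N) (c, d) (q, r) (?V t (c, d)) (?V t (c, d)) u = 0"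
      using geodesic_acceleration[OF \<gamma> t cd] unfolding qr by blast
    have Vs: "?V s (c, d) = (?v s c, ?w s d)" if "s \<in> {0..1} \<inter> T" for s
      using vw(3)[of s] T(3)[of s] that c d by (auto simp: mem_Times_iff)
    have "((\<lambda>s. fst (?V s (c, d))) has_vector_derivative fst E) (at t within {0..1})"
      by (rule bounded_linear.has_vector_derivative[OF bounded_linear_fst E(1)])
    then have "((\<lambda>s. ?v s c) has_vector_derivative fst E) (at t within {0..1})"
      by (rule has_vector_derivative_transform_nhd[OF _ T(1,2) t]) (simp add: Vs)
    moreover have "((\<lambda>s. snd (?V s (c, d))) has_vector_derivative snd E) (at t within {0..1})"
      by (rule bounded_linear.has_vector_derivative[OF bounded_linear_snd E(1)])
    then have "((\<lambda>s. ?w s d) has_vector_derivative snd E) (at t within {0..1})"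
      by (rule has_vector_derivative_transform_nhd[OF _ T(1,2) t]) (simp add: Vs)
    \<comment> \<open>pairing with \<open>(u, 0)\<close> and \<open>(0, u)\<close>: every term of the other factor is linear in the vector \<open>0\<close>\<close>
    moreover have "coeff M c q (fst E) u + christoffel M c q (?v t c) (?v t c) u = 0" for u
      using E(2)[of "(u, 0)"] Vs[of t] t T(2) christoffel_zero[OF N d(1) ri]
        bilinear_rzero[OF coeff_bilinear[OF N d(1) ri]]
      by (simp add: christoffel_prod[OF M c(1) qi N d(1) ri])
    moreover have "coeff N d r (snd E) u + christoffel N d r (?w t d) (?w t d) u = 0" for u
      using E(2)[of "(0, u)"] Vs[of t] t T(2) christoffel_zero[OF M c(1) qi]
        bilinear_rzero[OF coeff_bilinear[OF M c(1) qi]]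
      by (simp add: christoffel_prod[OF M c(1) qi N d(1) ri])
    ultimately show ?thesis unfolding q_def[symmetric] r_def[symmetric] by blast
  qed
  show "geodesic M (fst \<circ> \<gamma>)" unfolding geodesic_def
  proof (intro ballI conjI impI)
    fix t :: real assume t: "t \<in> {0..1}"
    show "has_velocity M {0..1} (fst \<circ> \<gamma>) (?v t) t" using vw(1)[OF t] .
    obtain d where d: "d \<in> charts N" "(snd \<circ> \<gamma>) t \<in> cdom N d"
      using obtain_chart[OF has_velocityD(1)[OF vw(2)[OF t]]] .
    fix c assume c: "c \<in> charts M" "(fst \<circ> \<gamma>) t \<in> cdom M c"
    show "\<exists>A. ((\<lambda>s. ?v s c) has_vector_derivative A) (at t within {0..1}) \<and>
      (\<forall>u. coeff M c (cmap M c ((fst \<circ> \<gamma>) t)) A u +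
        christoffel M c (cmap M c ((fst \<circ> \<gamma>) t)) (?v t c) (?v t c) u = 0)"
      using eq[OF t c d] by blast
  qed
  show "geodesic N (snd \<circ> \<gamma>)" unfolding geodesic_def
  proof (intro ballI conjI impI)
    fix t :: real assume t: "t \<in> {0..1}"
    show "has_velocity N {0..1} (snd \<circ> \<gamma>) (?w t) t" using vw(2)[OF t] .
    obtain c where c: "c \<in> charts M" "(fst \<circ> \<gamma>) t \<in> cdom M c"
      using obtain_chart[OF has_velocityD(1)[OF vw(1)[OF t]]] .
    fix d assume d: "d \<in> charts N" "(snd \<circ> \<gamma>) t \<in> cdom N d"
    show "\<exists>B. ((\<lambda>s. ?w s d) has_vector_derivative B) (at t within {0..1}) \<and>
      (\<forall>u. coeff N d (cmap N d ((snd \<circ> \<gamma>) t)) B u +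
        christoffel N d (cmap N d ((snd \<circ> \<gamma>) t)) (?w t d) (?w t d) u = 0)"
      using eq[OF t c d] by blast
  qed
qed

section \<open>Distance and logarithm of a product\<close>

lemma minimizing_geodesicD:
  assumes "minimizing_geodesic M p q \<gamma>"
  shows "geodesic M \<gamma>" "\<gamma> 0 = p" "\<gamma> 1 = q" "curve_length M \<gamma> = riem_dist M p q"
  using assms unfolding minimizing_geodesic_def by auto

lemma minimizing_geodesic_dist_nonneg:
  assumes "riemannian_manifold M" "minimizing_geodesic M p q \<gamma>"
  shows "riem_dist M p q \<ge> 0"
  using curve_length_nonneg[OF assms(1) geodesic_piecewise_C1] minimizing_geodesicD[OF assms(2)] by metis

text \<open>For geodesics the Cauchy-Schwarz step in the length estimate is an equality: the speeds of both components
  are constant, hence equal to their lengths.\<close>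

lemma geodesic_prod_length:
  assumes M: "riemannian_manifold M" and N: "riemannian_manifold N"
    and \<gamma>: "geodesic (riem_prod M N) \<gamma>"
  shows "curve_length (riem_prod M N) \<gamma> =
    sqrt ((curve_length M (fst \<circ> \<gamma>))\<^sup>2 + (curve_length N (snd \<circ> \<gamma>))\<^sup>2)"
proof -
  have "speed (riem_prod M N) \<gamma> t =
      sqrt ((curve_length M (fst \<circ> \<gamma>))\<^sup>2 + (curve_length N (snd \<circ> \<gamma>))\<^sup>2)" if t: "t \<in> {0..1}" for t
    using speed_prod[OF M N geodesic_velocity[OF \<gamma> t] t]
      geodesic_constant_speed[OF M geodesic_prodD(1)[OF M N \<gamma>] t]
      geodesic_constant_speed[OF N geodesic_prodD(2)[OF M N \<gamma>] t] by simp
  then have "integral {0..1} (speed (riem_prod M N) \<gamma>) = integral {0..1::real}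
      (\<lambda>t. sqrt ((curve_length M (fst \<circ> \<gamma>))\<^sup>2 + (curve_length N (snd \<circ> \<gamma>))\<^sup>2))"
    by (intro integral_cong) auto
  then show ?thesis by (simp add: curve_length_speed)
qed

text \<open>The lower bound holds for every competitor, since its components compete in the factors; the
  product of the two minimizing geodesics attains it.\<close>

lemma riem_dist_prod:
  assumes M: "riemannian_manifold M" and N: "riemannian_manifold N"
    and \<alpha>: "minimizing_geodesic M p p' \<alpha>" and \<beta>: "minimizing_geodesic N q q' \<beta>"
  shows "riem_dist (riem_prod M N) (p, q) (p', q') = sqrt ((riem_dist M p p')\<^sup>2 + (riem_dist N q q')\<^sup>2)"
    and "minimizing_geodesic (riem_prod M N) (p, q) (p', q') (\<lambda>t. (\<alpha> t, \<beta> t))"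
proof -
  let ?d = "sqrt ((riem_dist M p p')\<^sup>2 + (riem_dist N q q')\<^sup>2)"
  let ?\<gamma> = "\<lambda>t. (\<alpha> t, \<beta> t)"
  note \<alpha>' = minimizing_geodesicD[OF \<alpha>] and \<beta>' = minimizing_geodesicD[OF \<beta>]
  have \<gamma>: "geodesic (riem_prod M N) ?\<gamma>" using geodesic_Pair[OF M N \<alpha>'(1) \<beta>'(1)] .
  have L: "curve_length (riem_prod M N) ?\<gamma> = ?d"
    using geodesic_prod_length[OF M N \<gamma>] \<alpha>'(4) \<beta>'(4) by (simp add: o_def)
  let ?S = "{curve_length (riem_prod M N) \<gamma> | \<gamma>.
    piecewise_C1_curve (riem_prod M N) \<gamma> \<and> \<gamma> 0 = (p, q) \<and> \<gamma> 1 = (p', q')}"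
  have mem: "?d \<in> ?S"
    using L geodesic_piecewise_C1[OF \<gamma>] \<alpha>' \<beta>' by (intro CollectI exI[of _ ?\<gamma>]) auto
  have le: "?d \<le> l" if l: "l \<in> ?S" for l
  proof -
    obtain \<delta> where \<delta>: "l = curve_length (riem_prod M N) \<delta>" "piecewise_C1_curve (riem_prod M N) \<delta>"
      "\<delta> 0 = (p, q)" "\<delta> 1 = (p', q')" using l by blast
    note \<delta>12 = piecewise_C1_curve_prod[OF M N \<delta>(2)]
    have "riem_dist M p p' \<le> curve_length M (fst \<circ> \<delta>)"
      by (rule riem_dist_le_length[OF M \<delta>12(1)]) (use \<delta> in auto)
    moreover have "riem_dist N q q' \<le> curve_length N (snd \<circ> \<delta>)"
      by (rule riem_dist_le_length[OF N \<delta>12(2)]) (use \<delta> in auto)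
    ultimately have "?d \<le> sqrt ((curve_length M (fst \<circ> \<delta>))\<^sup>2 + (curve_length N (snd \<circ> \<delta>))\<^sup>2)"
      using minimizing_geodesic_dist_nonneg[OF M \<alpha>] minimizing_geodesic_dist_nonneg[OF N \<beta>]
      by (intro real_sqrt_le_mono add_mono power_mono)
    also have "\<dots> \<le> l" unfolding \<delta>(1) by (rule curve_length_prod_ge[OF M N \<delta>(2)])
    finally show ?thesis .
  qed
  show d: "riem_dist (riem_prod M N) (p, q) (p', q') = ?d"
    unfolding riem_dist_def[of "riem_prod M N"] by (rule cInf_eq_minimum[OF mem]) (rule le)
  show "minimizing_geodesic (riem_prod M N) (p, q) (p', q') ?\<gamma>"
    unfolding minimizing_geodesic_def using \<gamma> L d \<alpha>' \<beta>' by simp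
qed

text \<open>Each component is at least as long as the distance of its end points, and the squares of the two
  lengths have the same sum as the squares of the distances; so both are equalities.\<close>

lemma minimizing_geodesic_prodD:
  assumes M: "riemannian_manifold M" and N: "riemannian_manifold N"
    and \<alpha>: "minimizing_geodesic M p p' \<alpha>" and \<beta>: "minimizing_geodesic N q q' \<beta>"
    and \<gamma>: "minimizing_geodesic (riem_prod M N) (p, q) (p', q') \<gamma>"
  shows "minimizing_geodesic M p p' (fst \<circ> \<gamma>)" and "minimizing_geodesic N q q' (snd \<circ> \<gamma>)"
proof -
  note \<gamma>' = minimizing_geodesicD[OF \<gamma>]
  note g = geodesic_prodD[OF M N \<gamma>'(1)]
  define a b a' b' where "a = riem_dist M p p'" and "b = riem_dist N q q'"
    and "a' = curve_length M (fst \<circ> \<gamma>)" and "b' = curve_length N (snd \<circ> \<gamma>)"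
  have ends: "(fst \<circ> \<gamma>) 0 = p" "(fst \<circ> \<gamma>) 1 = p'" "(snd \<circ> \<gamma>) 0 = q" "(snd \<circ> \<gamma>) 1 = q'"
    using \<gamma>' by auto
  have le: "0 \<le> a" "0 \<le> b" "a \<le> a'" "b \<le> b'"
    unfolding a_def b_def a'_def b'_def
    using minimizing_geodesic_dist_nonneg[OF M \<alpha>] minimizing_geodesic_dist_nonneg[OF N \<beta>]
      riem_dist_le_length[OF M geodesic_piecewise_C1[OF g(1)]]
      riem_dist_le_length[OF N geodesic_piecewise_C1[OF g(2)]] ends by auto
  then have "a\<^sup>2 \<le> a'\<^sup>2" "b\<^sup>2 \<le> b'\<^sup>2" by (auto intro: power_mono)
  moreover have "a'\<^sup>2 + b'\<^sup>2 = a\<^sup>2 + b\<^sup>2"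
    using geodesic_prod_length[OF M N \<gamma>'(1)] \<gamma>'(4) riem_dist_prod(1)[OF M N \<alpha> \<beta>]
    by (simp add: a_def b_def a'_def b'_def)
  ultimately have "a'\<^sup>2 = a\<^sup>2" "b'\<^sup>2 = b\<^sup>2" by linarith+
  then have "a' = a" "b' = b" using le by (simp_all add: power2_eq_iff_nonneg)
  then show "minimizing_geodesic M p p' (fst \<circ> \<gamma>)" "minimizing_geodesic N q q' (snd \<circ> \<gamma>)"
    unfolding minimizing_geodesic_def using g ends by (simp_all add: a_def b_def a'_def b'_def)
qed

lemma riem_log_eqI:
  assumes \<gamma>: "minimizing_geodesic M p q \<gamma>"
    and unique: "\<And>\<gamma>' t. minimizing_geodesic M p q \<gamma>' \<Longrightarrow> t \<in> {0..1} \<Longrightarrow> \<gamma>' t = \<gamma> t"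
    and v: "has_velocity M {0..1} \<gamma> v 0"
  shows "riem_log M p q = v"
  unfolding riem_log_def
proof (rule the_equality)
  show "\<exists>\<gamma>. minimizing_geodesic M p q \<gamma> \<and> has_velocity M {0..1} \<gamma> v 0" using \<gamma> v by blast
  fix w assume "\<exists>\<gamma>. minimizing_geodesic M p q \<gamma> \<and> has_velocity M {0..1} \<gamma> w 0"
  then obtain \<gamma>' where \<gamma>': "minimizing_geodesic M p q \<gamma>'" "has_velocity M {0..1} \<gamma>' w 0" by blast
  have "has_velocity M {0..1} \<gamma> w 0"
    by (rule has_velocity_transform[OF \<gamma>'(2)]) (use unique[OF \<gamma>'(1)] in auto)
  then show "w = v" using has_velocity_unique[OF _ v] at_within_Icc_nontrivial[of 0 1 0] by simp
qed

lemma geodesically_convexE: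
  assumes "geodesically_convex M U" "p \<in> U" "q \<in> U"
  obtains \<gamma> where "minimizing_geodesic M p q \<gamma>"
    "\<And>\<gamma>' t. minimizing_geodesic M p q \<gamma>' \<Longrightarrow> t \<in> {0..1} \<Longrightarrow> \<gamma>' t = \<gamma> t"
    "has_velocity M {0..1} \<gamma> (riem_log M p q) 0"
proof -
  obtain \<gamma> where \<gamma>: "minimizing_geodesic M p q \<gamma>"
    "\<And>\<gamma>' t. minimizing_geodesic M p q \<gamma>' \<Longrightarrow> t \<in> {0..1} \<Longrightarrow> \<gamma>' t = \<gamma> t"
    using assms unfolding geodesically_convex_def by metis
  have v: "has_velocity M {0..1} \<gamma> (velocity M {0..1} \<gamma> 0) 0"
    using geodesic_velocity[OF minimizing_geodesicD(1)[OF \<gamma>(1)]] by simp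
  have "riem_log M p q = velocity M {0..1} \<gamma> 0"
    by (rule riem_log_eqI[OF \<gamma>(1) _ v]) (rule \<gamma>(2))
  then have "has_velocity M {0..1} \<gamma> (riem_log M p q) 0" using v by simp
  then show ?thesis by (rule that[OF \<gamma>(1), rotated]) (rule \<gamma>(2))
qed

text \<open>The components of any minimizing geodesic of the product are minimizing, hence determined on
  \<open>[0,1]\<close> by convexity of the two sets. So the logarithm of the product is the initial velocity of the product of
  the two minimizing geodesics.\<close>

lemma riem_log_prod:
  assumes M: "riemannian_manifold M" and N: "riemannian_manifold N"
    and U: "geodesically_convex M U" "p \<in> U" "p' \<in> U"
    and W: "geodesically_convex N W" "q \<in> W" "q' \<in> W"
  shows "riem_log (riem_prod M N) (p, q) (p', q') =
    prod_tangent M N p q (riem_log M p p') (riem_log N q q')"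
proof -
  obtain \<alpha> where \<alpha>: "minimizing_geodesic M p p' \<alpha>"
    "\<And>\<gamma>' t. minimizing_geodesic M p p' \<gamma>' \<Longrightarrow> t \<in> {0..1} \<Longrightarrow> \<gamma>' t = \<alpha> t"
    "has_velocity M {0..1} \<alpha> (riem_log M p p') 0"
    by (rule geodesically_convexE[OF U]) blast
  obtain \<beta> where \<beta>: "minimizing_geodesic N q q' \<beta>"
    "\<And>\<gamma>' t. minimizing_geodesic N q q' \<gamma>' \<Longrightarrow> t \<in> {0..1} \<Longrightarrow> \<gamma>' t = \<beta> t"
    "has_velocity N {0..1} \<beta> (riem_log N q q') 0"
    by (rule geodesically_convexE[OF W]) blast
  show ?thesis
  proof (rule riem_log_eqI)
    show "minimizing_geodesic (riem_prod M N) (p, q) (p', q') (\<lambda>t. (\<alpha> t, \<beta> t))"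
      by (rule riem_dist_prod(2)[OF M N \<alpha>(1) \<beta>(1)])
    show "\<gamma> t = (\<alpha> t, \<beta> t)"
      if "minimizing_geodesic (riem_prod M N) (p, q) (p', q') \<gamma>" "t \<in> {0..1}" for \<gamma> t
      using \<alpha>(2)[OF minimizing_geodesic_prodD(1)[OF M N \<alpha>(1) \<beta>(1) that(1)] that(2)]
        \<beta>(2)[OF minimizing_geodesic_prodD(2)[OF M N \<alpha>(1) \<beta>(1) that(1)] that(2)]
      by (simp add: prod_eq_iff)
    show "has_velocity (riem_prod M N) {0..1} (\<lambda>t. (\<alpha> t, \<beta> t))
        (prod_tangent M N p q (riem_log M p p') (riem_log N q q')) 0"
      using has_velocity_Pair[OF M N \<alpha>(3) \<beta>(3)] minimizing_geodesicD(2)[OF \<alpha>(1)]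
        minimizing_geodesicD(2)[OF \<beta>(1)] by simp
  qed
qed

lemma riem_dist_prod_convex:
  assumes M: "riemannian_manifold M" and N: "riemannian_manifold N"
    and U: "geodesically_convex M U" "p \<in> U" "p' \<in> U"
    and W: "geodesically_convex N W" "q \<in> W" "q' \<in> W"
  shows "riem_dist (riem_prod M N) (p, q) (p', q') = sqrt ((riem_dist M p p')\<^sup>2 + (riem_dist N q q')\<^sup>2)"
  by (rule geodesically_convexE[OF U], rule geodesically_convexE[OF W]) (rule riem_dist_prod(1)[OF M N])

lemma riem_log_outside_chart:
  assumes "geodesically_convex M U" "p \<in> U" "q \<in> U" "\<not> (c \<in> charts M \<and> p \<in> cdom M c)"
  shows "riem_log M p q c = 0"
proof -
  obtain \<gamma> where "minimizing_geodesic M p q \<gamma>" "has_velocity M {0..1} \<gamma> (riem_log M p q) 0"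
    by (rule geodesically_convexE[OF assms(1-3)]) blast
  then have "riem_log M p q \<in> tangent_space M p"
    using has_velocityD(3) minimizing_geodesicD(2) by metis
  then show ?thesis using assms(4) by (rule tangent_space_zero)
qed

section \<open>The aggregation system on a product\<close>

text \<open>The right-hand side of the aggregation system, as a function of the position \<open>p\<close> of one particle
  and the configuration \<open>P\<close> of all of them.\<close>

definition mean_log ::
  "('i, 'a::topological_space, 'e::euclidean_space) riemannian \<Rightarrow> nat \<Rightarrow> 'a \<Rightarrow> (nat \<Rightarrow> 'a) \<Rightarrow> 'i \<Rightarrow> 'e" where
  "mean_log M n p P = (\<lambda>c. (1 / real n) *\<^sub>R (\<Sum>j\<in>{1..n}. riem_log M p (P j) c))"

lemma global_solution_mean_log:
  "global_solution M U n x0 x \<longleftrightarrow>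
     (\<forall>i\<in>{1..n}. x i 0 = x0 i \<and>
        (\<forall>t\<ge>0. x i t \<in> U \<and> has_velocity M {0..} (x i) (mean_log M n (x i t) (\<lambda>j. x j t)) t))"
  unfolding global_solution_def mean_log_def ..

lemma mean_log_prod:
  assumes M: "riemannian_manifold M" and N: "riemannian_manifold N"
    and U: "geodesically_convex M U" "p \<in> U" "\<And>j. j \<in> {1..n} \<Longrightarrow> P j \<in> U"
    and W: "geodesically_convex N W" "q \<in> W" "\<And>j. j \<in> {1..n} \<Longrightarrow> Q j \<in> W"
  shows "mean_log (riem_prod M N) n (p, q) (\<lambda>j. (P j, Q j)) =
    prod_tangent M N p q (mean_log M n p P) (mean_log N n q Q)"
proof -
  have "(\<Sum>j\<in>{1..n}. riem_log (riem_prod M N) (p, q) (P j, Q j) e) =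
      (\<Sum>j\<in>{1..n}. prod_tangent M N p q (riem_log M p (P j)) (riem_log N q (Q j)) e)" for e
    using riem_log_prod[OF M N U(1,2) _ W(1,2)] U(3) W(3) by (intro sum.cong) auto
  then show ?thesis
    by (auto simp: mean_log_def prod_tangent_def fun_eq_iff prod_eq_iff fst_sum snd_sum)
qed

lemma global_solution_Pair:
  assumes M: "riemannian_manifold M" and N: "riemannian_manifold N"
    and U: "geodesically_convex M U" and W: "geodesically_convex N W"
    and x: "global_solution M U n x0 x" and y: "global_solution N W n y0 y"
  shows "global_solution (riem_prod M N) (U \<times> W) n (\<lambda>i. (x0 i, y0 i)) (\<lambda>i t. (x i t, y i t))"
  unfolding global_solution_mean_log
proof (intro ballI conjI allI impI)
  note x = x[unfolded global_solution_mean_log] and y = y[unfolded global_solution_mean_log]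
  fix i assume i: "i \<in> {1..n}"
  show "(x i 0, y i 0) = (x0 i, y0 i)" using x y i by simp
  fix t :: real assume t: "t \<ge> 0"
  show "(x i t, y i t) \<in> U \<times> W" using x y i t by simp
  have "mean_log (riem_prod M N) n (x i t, y i t) (\<lambda>j. (x j t, y j t)) =
      prod_tangent M N (x i t) (y i t) (mean_log M n (x i t) (\<lambda>j. x j t)) (mean_log N n (y i t) (\<lambda>j. y j t))"
    by (rule mean_log_prod[OF M N U _ _ W]) (use x y i t in auto)
  then show "has_velocity (riem_prod M N) {0..} (\<lambda>t. (x i t, y i t))
      (mean_log (riem_prod M N) n (x i t, y i t) (\<lambda>j. (x j t, y j t))) t"
    using has_velocity_Pair[OF M N, of "{0..}" "x i" _ t "y i"] x y i t by simp
qed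

text \<open>The velocity of \<open>z\<^sub>i\<close> splits into velocities of its components, and the right-hand side splits
  into the right-hand sides of the factors; comparing the two splittings of the same tangent vector
  of the product gives the equations of the factors.\<close>

lemma global_solution_prodD:
  assumes M: "riemannian_manifold M" and N: "riemannian_manifold N"
    and U: "geodesically_convex M U" and W: "geodesically_convex N W"
    and z: "global_solution (riem_prod M N) (U \<times> W) n (\<lambda>i. (x0 i, y0 i)) z"
  shows "global_solution M U n x0 (\<lambda>i. fst \<circ> z i)" and "global_solution N W n y0 (\<lambda>i. snd \<circ> z i)"
proof -
  note z = z[unfolded global_solution_mean_log]
  have vel: "has_velocity M {0..} (fst \<circ> z i) (mean_log M n ((fst \<circ> z i) t) (\<lambda>j. (fst \<circ> z j) t)) t \<and>
      has_velocity N {0..} (snd \<circ> z i) (mean_log N n ((snd \<circ> z i) t) (\<lambda>j. (snd \<circ> z j) t)) t"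
    if i: "i \<in> {1..n}" and t: "t \<ge> 0" for i t
  proof -
    define p q where "p = fst (z i t)" and "q = snd (z i t)"
    define P Q where "P = (\<lambda>j. fst (z j t))" and "Q = (\<lambda>j. snd (z j t))"
    have mem: "p \<in> U" "q \<in> W" "\<And>j. j \<in> {1..n} \<Longrightarrow> P j \<in> U" "\<And>j. j \<in> {1..n} \<Longrightarrow> Q j \<in> W"
      using z i t by (auto simp: p_def q_def P_def Q_def mem_Times_iff)
    have V: "has_velocity (riem_prod M N) {0..} (z i) (mean_log (riem_prod M N) n (z i t) (\<lambda>j. z j t)) t"
      using z i t by blast
    obtain v w where vw: "has_velocity M {0..} (fst \<circ> z i) v t" "has_velocity N {0..} (snd \<circ> z i) w t"
      "mean_log (riem_prod M N) n (z i t) (\<lambda>j. z j t) = prod_tangent M N p q v w"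
      using has_velocity_prodE[OF M N V] unfolding p_def q_def by blast
    have "prod_tangent M N p q v w = prod_tangent M N p q (mean_log M n p P) (mean_log N n q Q)"
    proof -
      have "mean_log (riem_prod M N) n (p, q) (\<lambda>j. (P j, Q j)) =
          prod_tangent M N p q (mean_log M n p P) (mean_log N n q Q)"
        by (rule mean_log_prod[OF M N U mem(1) _ W mem(2)]) (use mem(3,4) in auto)
      then show ?thesis using vw(3) by (simp add: p_def q_def P_def Q_def)
    qed
    moreover have "v c = mean_log M n p P c" if "\<not> (c \<in> charts M \<and> p \<in> cdom M c)" for c
      using tangent_space_zero[OF has_velocityD(3)[OF vw(1)], of c] that
        riem_log_outside_chart[OF U mem(1) mem(3) that] by (simp add: mean_log_def p_def)
    moreover have "w d = mean_log N n q Q d" if "\<not> (d \<in> charts N \<and> q \<in> cdom N d)" for d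
      using tangent_space_zero[OF has_velocityD(3)[OF vw(2)], of d] that
        riem_log_outside_chart[OF W mem(2) mem(4) that] by (simp add: mean_log_def q_def)
    moreover have "p \<in> points M" "q \<in> points N"
      using has_velocityD(1)[OF vw(1)] has_velocityD(1)[OF vw(2)] by (simp_all add: p_def q_def)
    ultimately have "v = mean_log M n p P" "w = mean_log N n q Q"
      using prod_tangent_inject[of p M q N v "mean_log M n p P" w "mean_log N n q Q"] by blast+
    then show ?thesis using vw(1,2) by (simp add: p_def q_def P_def Q_def)
  qed
  show "global_solution M U n x0 (\<lambda>i. fst \<circ> z i)" "global_solution N W n y0 (\<lambda>i. snd \<circ> z i)"
    unfolding global_solution_mean_log using z vel by (auto simp: mem_Times_iff)
qed

theorem proposition5p9:
  fixes M1 :: "('i, 'a::{t2_space,second_countable_topology}, 'e::euclidean_space) riemannian"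
    and M2 :: "('j, 'b::{t2_space,second_countable_topology}, 'f::euclidean_space) riemannian"
    and U1 :: "'a set" and U2 :: "'b set"
    and n :: nat
    and x0 :: "nat \<Rightarrow> 'a" and y0 :: "nat \<Rightarrow> 'b"
    and x :: "nat \<Rightarrow> real \<Rightarrow> 'a" and y :: "nat \<Rightarrow> real \<Rightarrow> 'b"
  assumes "riemannian_manifold M1" and "complete_riemannian M1" and "connected (points M1)"
    and "riemannian_manifold M2" and "complete_riemannian M2" and "connected (points M2)"
    and "open U1" and "geodesically_convex M1 U1"
    and "open U2" and "geodesically_convex M2 U2"
    and "n \<ge> 1"
    and "\<And>i. i \<in> {1..n} \<Longrightarrow> (x0 i, y0 i) \<in> U1 \<times> U2"
    and "unique_global_solution M1 U1 n x0 x"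
    and "unique_global_solution M2 U2 n y0 y"
    and "\<And>i j. i \<in> {1..n} \<Longrightarrow> j \<in> {1..n} \<Longrightarrow>
           ((\<lambda>t. riem_dist M1 (x i t) (x j t)) \<longlongrightarrow> 0) at_top"
    and "\<And>i j. i \<in> {1..n} \<Longrightarrow> j \<in> {1..n} \<Longrightarrow>
           ((\<lambda>t. riem_dist M2 (y i t) (y j t)) \<longlongrightarrow> 0) at_top"
  shows "unique_global_solution (riem_prod M1 M2) (U1 \<times> U2) n
           (\<lambda>i. (x0 i, y0 i)) (\<lambda>i t. (x i t, y i t)) \<and>
         (\<forall>i\<in>{1..n}. \<forall>j\<in>{1..n}.
           ((\<lambda>t. riem_dist (riem_prod M1 M2) (x i t, y i t) (x j t, y j t)) \<longlongrightarrow> 0) at_top)"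
proof -
  note M = assms(1) and N = assms(4) and U = assms(8) and W = assms(10)
  note dx = assms(15) and dy = assms(16)
  have x: "global_solution M1 U1 n x0 x" "\<And>x' i t. global_solution M1 U1 n x0 x' \<Longrightarrow> i \<in> {1..n} \<Longrightarrow> t \<ge> 0 \<Longrightarrow> x' i t = x i t"
    using assms(13) unfolding unique_global_solution_def by blast+
  have y: "global_solution M2 U2 n y0 y" "\<And>y' i t. global_solution M2 U2 n y0 y' \<Longrightarrow> i \<in> {1..n} \<Longrightarrow> t \<ge> 0 \<Longrightarrow> y' i t = y i t"
    using assms(14) unfolding unique_global_solution_def by blast+
  have "unique_global_solution (riem_prod M1 M2) (U1 \<times> U2) n (\<lambda>i. (x0 i, y0 i)) (\<lambda>i t. (x i t, y i t))"
    unfolding unique_global_solution_def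
  proof (intro conjI allI impI ballI)
    show "global_solution (riem_prod M1 M2) (U1 \<times> U2) n (\<lambda>i. (x0 i, y0 i)) (\<lambda>i t. (x i t, y i t))"
      by (rule global_solution_Pair[OF M N U W x(1) y(1)])
    fix z i and t :: real
    assume z: "global_solution (riem_prod M1 M2) (U1 \<times> U2) n (\<lambda>i. (x0 i, y0 i)) z"
      and it: "i \<in> {1..n}" "0 \<le> t"
    show "z i t = (x i t, y i t)"
      using x(2)[OF global_solution_prodD(1)[OF M N U W z] it] y(2)[OF global_solution_prodD(2)[OF M N U W z] it]
      by (simp add: prod_eq_iff)
  qed
  moreover have "((\<lambda>t. riem_dist (riem_prod M1 M2) (x i t, y i t) (x j t, y j t)) \<longlongrightarrow> 0) at_top"
    if ij: "i \<in> {1..n}" "j \<in> {1..n}" for i j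
  proof -
    have "((\<lambda>t. sqrt ((riem_dist M1 (x i t) (x j t))\<^sup>2 + (riem_dist M2 (y i t) (y j t))\<^sup>2)) \<longlongrightarrow>
        sqrt (0\<^sup>2 + 0\<^sup>2)) at_top"
      by (intro tendsto_intros dx[OF ij] dy[OF ij])
    moreover have "eventually (\<lambda>t. sqrt ((riem_dist M1 (x i t) (x j t))\<^sup>2 + (riem_dist M2 (y i t) (y j t))\<^sup>2) =
        riem_dist (riem_prod M1 M2) (x i t, y i t) (x j t, y j t)) at_top"
      using eventually_ge_at_top[of 0]
    proof eventually_elim
      case (elim t)
      then have "x i t \<in> U1" "x j t \<in> U1" "y i t \<in> U2" "y j t \<in> U2"
        using x(1) y(1) ij unfolding global_solution_def by auto
      then show ?case using riem_dist_prod_convex[OF M N U _ _ W] by simp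
    qed
    ultimately show ?thesis by (simp add: tendsto_cong)
  qed
  ultimately show ?thesis by blast
qed

end
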